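(* Let $X_0,\dots,X_{n-1}$ be a sample of length $n\in\mathbb{N}$ of a stationary, geometrically ergodic Markov process with finite state-space $\mathcal{X}$, and let $\eta,\gamma\in(0,\infty)$ be such that its $\beta$-mixing coefficients satisfy $\beta(j)\le\eta e^{-\gamma j}$ for all $j\in\mathbb{N}$. Let $$k^\star:=\left\lfloor\frac1\gamma\log\left(\frac{\eta\gamma n^{3/2}}{\sqrt2|\mathcal{X}|}\right)\right\rfloor,\qquad N:=\left\lfloor\frac{n-k^\star}{2(k^\star+1)}\right\rfloor,$$ with $$n\ge\max\left\{\left(\frac{\sqrt2|\mathcal{X}|e^{2\gamma}}{\eta\gamma}\right)^{2/3},\left(\frac{\eta\gamma}{|\mathcal{X}|}\right)^{2/3}\right\}.$$ For every $m=1,\dots,k^\star$, with $\hat\beta_N(m)$ the empirical estimator of $\beta(m)$ (defined in the context) with lag $k=k^\star$, we have $$\mathbb{E}|\hat\beta_N(m)-\beta(m)|\le\frac{\sqrt8|\mathcal{X}|n^{-1/2}}{\gamma}\left(e+\log\left(\frac{\eta\gamma}{\sqrt2|\mathcal{X}|}\right)+\frac32\log n\right).$$ Moreover, for every $\epsilon>0$, $$\Pr(|\hat\beta_N(m)-\beta(m)|\ge\epsilon)\le\frac{e\sqrt2|\mathcal{X}|n^{-1/2}}{2\log\left(\frac{\eta\gamma n^{3/2}}{\sqrt2|\mathcal{X}|}\right)}+4|\mathcal{X}|^2\exp\left\{-\frac{\gamma n\epsilon^2}{48|\mathcal{X}|^4\log n}\right\}.$$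
   Context: Conventions: $\mathbb{N}=\{0,1,2,\dots\}$; $\log$ is the natural logarithm; the state-space $\mathcal{X}\subset\mathbb{R}$ is finite. Let $P_m$ denote the law of $(X_0,X_m)$ and $P_0$ the law of $X_0$. For a stationary Markov process with finite state-space the $\beta$-mixing coefficients are $$\beta(m)=\beta(\sigma(X_0),\sigma(X_m))=\frac12\sum_{u\in\mathcal{X}}\sum_{v\in\mathcal{X}}|P_m(\{(u,v)\})-P_0(\{u\})P_0(\{v\})|.$$ Geometric ergodicity: a stationary Markov process with marginal law $\rho$ is geometrically ergodic if there exist Borel functions $f,c:\mathbb{R}\to(0,\infty)$ such that for $\rho$-a.e. $x$ and every $m\in\mathbb{N}$, $\sup_{B\in\mathcal{B}(\mathbb{R})}|p_m(x,B)-\rho(B)|\le f(x)e^{-c(x)m}$, where $p_m(x,\cdot)$ is the regular conditional distribution of $X_m$ given $X_0=x$. Estimator: for a lag $k\in\{1,\dots,n\}$ let $N=N(k,n)=\lfloor\frac{n-k}{2(k+1)}\rfloor$ (at least $1$, so that the estimator is defined), $Z_i=(X_{2i(k+1)},X_{2i(k+1)+m})$ for $i=0,\dots,N-1$, and $$\hat P_{m,N}(\{(u,v)\})=\frac1N\sum_{i=0}^{N-1}\mathbf{1}_{\{(u,v)\}}(Z_i),\qquad\hat P_{0,N}(\{u\})=\frac1{2N}\sum_{i=0}^{2N-1}\mathbf{1}_{\{u\}}(X_{ki}),$$ $$\hat\beta_N(m)=\frac12\sum_{u\in\mathcal{X}}\sum_{v\in\mathcal{X}}|\hat P_{m,N}(\{(u,v)\})-\hat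 P_{0,N}(\{u\})\hat P_{0,N}(\{v\})|.$$ *)

theory Defs
  imports "HOL-Probability.Probability"
begin

definition stationary_process :: "'a measure \<Rightarrow> (nat \<Rightarrow> 'a \<Rightarrow> real) \<Rightarrow> bool" where
  "stationary_process M X \<longleftrightarrow>
     (\<forall>s. distr M (\<Pi>\<^sub>M t\<in>UNIV. borel) (\<lambda>\<omega> t. X (s + t) \<omega>)
        = distr M (\<Pi>\<^sub>M t\<in>UNIV. borel) (\<lambda>\<omega> t. X t \<omega>))"

text \<open>The elementary Markov property, adequate because it is only used for processes
  with finitely many values.  Time-homogeneity is not required here; it comes from stationarity.\<close>

definition markov_process :: "'a measure \<Rightarrow> (nat \<Rightarrow> 'a \<Rightarrow> real) \<Rightarrow> bool" where
  "markov_process M X \<longleftrightarrow>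
     (\<forall>t x y. \<P>(\<omega> in M. \<forall>i\<le>t. X i \<omega> = x i) > 0 \<longrightarrow>
        \<P>(\<omega> in M. X (Suc t) \<omega> = y \<bar> \<forall>i\<le>t. X i \<omega> = x i)
          = \<P>(\<omega> in M. X (Suc t) \<omega> = y \<bar> X t \<omega> = x t))"

text \<open>\<open>\<kappa>\<close> is a regular version of the conditional distribution of \<open>Z\<close> given \<open>Y\<close>.
  It is unique up to null sets of the law of \<open>Y\<close>.\<close>

definition regular_cond_distr ::
  "'a measure \<Rightarrow> ('a \<Rightarrow> real) \<Rightarrow> ('a \<Rightarrow> real) \<Rightarrow> (real \<Rightarrow> real measure) \<Rightarrow> bool" where
  "regular_cond_distr M Z Y \<kappa> \<longleftrightarrow>
     \<kappa> \<in> borel \<rightarrow>\<^sub>M prob_algebra borel \<and>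
     (\<forall>A\<in>sets borel. \<forall>B\<in>sets borel.
        emeasure M {\<omega> \<in> space M. Y \<omega> \<in> A \<and> Z \<omega> \<in> B}
          = (\<integral>\<^sup>+x\<in>A. emeasure (\<kappa> x) B \<partial>distr M borel Y))"

text \<open>Since \<open>p m\<close> is determined up to a null set of \<open>\<rho>\<close> and there are only countably many
  \<open>m\<close>, it does not matter which version of the conditional distributions is chosen.\<close>

definition geometrically_ergodic :: "'a measure \<Rightarrow> (nat \<Rightarrow> 'a \<Rightarrow> real) \<Rightarrow> bool" where
  "geometrically_ergodic M X \<longleftrightarrow>
     (let \<rho> = distr M borel (X 0) in
      \<exists>p f c. (\<forall>m. regular_cond_distr M (X m) (X 0) (p m)) \<and>
        f \<in> borel_measurable borel \<and> c \<in> borel_measurable borel \<and>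
        (\<forall>x. f x > 0) \<and> (\<forall>x. c x > 0) \<and>
        (AE x in \<rho>. \<forall>m.
           (SUP B\<in>sets borel. \<bar>measure (p m x) B - measure \<rho> B\<bar>) \<le> f x * exp (- c x * real m)))"

definition beta_coeff :: "'a measure \<Rightarrow> (nat \<Rightarrow> 'a \<Rightarrow> real) \<Rightarrow> real set \<Rightarrow> nat \<Rightarrow> real" where
  "beta_coeff M X S m =
     1 / 2 * (\<Sum>u\<in>S. \<Sum>v\<in>S.
       \<bar>measure (distr M (borel \<Otimes>\<^sub>M borel) (\<lambda>\<omega>. (X 0 \<omega>, X m \<omega>))) {(u, v)}
         - measure (distr M borel (X 0)) {u} * measure (distr M borel (X 0)) {v}\<bar>)"

definition emp_joint ::
  "(nat \<Rightarrow> 'a \<Rightarrow> real) \<Rightarrow> nat \<Rightarrow> nat \<Rightarrow> nat \<Rightarrow> 'a \<Rightarrow> real \<times> real \<Rightarrow> real" where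
  "emp_joint X k N m \<omega> z =
     1 / real N * (\<Sum>i<N. indicator {z} (X (2 * i * (k + 1)) \<omega>, X (2 * i * (k + 1) + m) \<omega>))"

definition emp_marginal ::
  "(nat \<Rightarrow> 'a \<Rightarrow> real) \<Rightarrow> nat \<Rightarrow> nat \<Rightarrow> 'a \<Rightarrow> real \<Rightarrow> real" where
  "emp_marginal X k N \<omega> u = 1 / (2 * real N) * (\<Sum>i<2 * N. indicator {u} (X (k * i) \<omega>))"

definition beta_hat ::
  "(nat \<Rightarrow> 'a \<Rightarrow> real) \<Rightarrow> real set \<Rightarrow> nat \<Rightarrow> nat \<Rightarrow> nat \<Rightarrow> 'a \<Rightarrow> real" where
  "beta_hat X S k N m \<omega> =
     1 / 2 * (\<Sum>u\<in>S. \<Sum>v\<in>S.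
       \<bar>emp_joint X k N m \<omega> (u, v) - emp_marginal X k N \<omega> u * emp_marginal X k N \<omega> v\<bar>)"

end

theory Submission
  imports Defs
begin

text \<open>
  Write \<open>\<pi>\<close> for the law of \<open>X\<^sub>0\<close> and \<open>J\<^sub>m\<close> for the law of \<open>(X\<^sub>0, X\<^sub>m)\<close>.  The empirical marginal is the
  average of the empirical frequencies of the two subsamples \<open>X\<^sub>2\<^sub>k\<^sub>i\<close> and \<open>X\<^sub>k\<^sub>+\<^sub>2\<^sub>k\<^sub>i\<close>, so the error of the
  estimator is at most half the sum of three \<open>\<ell>\<^sup>1\<close> deviations of empirical frequencies from their
  expectations: one for the \<open>N\<close> pairs and one for each marginal subsample of size \<open>N\<close>
  (lemma \<open>deviation_le\<close>).

  In each of these three samples consecutive observations are separated by a gap of more than \<open>k\<close>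
  steps: at least \<open>k + 2\<close> between pairs, and \<open>2 k\<close> in a marginal subsample.  By the Markov property,
  appending an observation after a gap \<open>g\<close> to everything before it changes the joint law by at most
  \<open>\<beta> g\<close> in total variation compared with appending an independent observation
  (\<open>mixing_past_events\<close>).  Hence the law of a sample of size \<open>N\<close> is within \<open>N \<beta> g\<close> of the product law
  (locale \<open>nearly_iid\<close>), and bounded functionals may be evaluated under independence at that price.
  There the mean deviation is controlled by the second moment and Cauchy--Schwarz, the tail by
  Hoeffding's inequality.  This gives \<open>mean_deviation\<close> and \<open>tail_deviation\<close>, with a total dependence
  error \<open>N (\<beta> (2 (k + 1) - m) + 2 \<beta> (2 k))\<close>.  Sampling the marginal in two classes, rather than
  treating \<open>X\<^sub>k\<^sub>i\<close> as one nearly independent sequence with gap \<open>k\<close>, avoids a loss of a factor \<open>exp \<gamma>\<close>.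

  Put \<open>A = \<eta> \<gamma> n\<^sup>3\<^sup>/\<^sup>2 / (\<surd>2 |S|)\<close>.  The choice of \<open>k\<close> makes
  \<open>N \<eta> exp (- \<gamma> (k + 1)) \<le> \<surd>2 |S| n\<^sup>-\<^sup>1\<^sup>/\<^sup>2 / (2 ln A)\<close>, and the two lower bounds on \<open>n\<close> imply \<open>k \<ge> 2\<close> and
  \<open>ln A \<le> 3 ln n\<close>.  For the tail bound the dependence error must not exceed \<open>exp 1\<close> times that
  quantity.  Since \<open>2 k\<close> exceeds \<open>k + 1\<close> by a fixed proportion, this holds when \<open>ln A \<ge> 1\<close>.  When
  \<open>ln A \<le> 1\<close>, the process is nearly constant instead: the mean error is at most \<open>4 \<beta> 0 \<le> 4 \<eta>\<close>, and
  Markov's inequality suffices unless \<open>\<epsilon> > 1\<close> or the exponential term is at least \<open>1\<close>, in which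
  cases there is nothing to prove.  The bound by \<open>\<beta> 0\<close> also covers the case of a single state.
\<close>

section \<open>Empirical frequencies\<close>

text \<open>
  The relative frequency of \<open>z\<close> among \<open>zs 0, \<dots>, zs (N - 1)\<close>.
\<close>

definition emp_freq :: "nat \<Rightarrow> (nat \<Rightarrow> 'z) \<Rightarrow> 'z \<Rightarrow> real" where
  "emp_freq N zs z = (\<Sum>i<N. indicator {z} (zs i)) / real N"

lemma emp_freq_nonneg: "0 \<le> emp_freq N zs z"
  unfolding emp_freq_def by (intro divide_nonneg_nonneg sum_nonneg) (auto simp: indicator_def)

lemma sum_emp_freq:
  assumes "finite T" "\<And>i. i < N \<Longrightarrow> zs i \<in> T" "0 < N"
  shows "(\<Sum>z\<in>T. emp_freq N zs z) = 1"
proof -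
  have "(\<Sum>z\<in>T. \<Sum>i<N. indicator {z} (zs i)) = (\<Sum>i<N. \<Sum>z\<in>T. indicator {z} (zs i) :: real)"
    by (rule sum.swap)
  also have "\<dots> = (\<Sum>i<N. 1)"
  proof (intro sum.cong refl)
    fix i assume "i \<in> {..<N}"
    then have "zs i \<in> T" using assms by auto
    have "(\<Sum>z\<in>T. indicator {z} (zs i) :: real) = (\<Sum>z\<in>T. if z = zs i then 1 else 0)"
      by (intro sum.cong) (auto simp: indicator_def)
    also have "\<dots> = 1" using \<open>zs i \<in> T\<close> assms(1) by (simp add: sum.delta)
    finally show "(\<Sum>z\<in>T. indicator {z} (zs i) :: real) = 1" .
  qed
  finally show ?thesis
    using assms(3) by (simp add: emp_freq_def flip: sum_divide_distrib)
qed

lemma emp_freq_cong: "(\<And>i. i < N \<Longrightarrow> zs i = zs' i) \<Longrightarrow> emp_freq N zs z = emp_freq N zs' z"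
  unfolding emp_freq_def by (intro arg_cong2[where f="(/)"] sum.cong refl) auto

lemma sum_abs_diff_emp_freq_le_2:
  assumes "finite T" "\<And>i. i < N \<Longrightarrow> zs i \<in> T" "0 < N"
    and "\<And>z. z \<in> T \<Longrightarrow> 0 \<le> p z" "(\<Sum>z\<in>T. p z) = 1"
  shows "(\<Sum>z\<in>T. \<bar>emp_freq N zs z - p z\<bar>) \<le> 2"
proof -
  have "(\<Sum>z\<in>T. \<bar>emp_freq N zs z - p z\<bar>) \<le> (\<Sum>z\<in>T. emp_freq N zs z + p z)"
    using assms(4) emp_freq_nonneg[of N zs] by (intro sum_mono) (smt (verit))
  also have "\<dots> = 2"
    using assms sum_emp_freq[OF assms(1-3)] by (simp add: sum.distrib)
  finally show ?thesis .
qed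

section \<open>Independent samples from a finite set\<close>

lemma sum_sqrt_le_sqrt_card:
  fixes p :: "'z \<Rightarrow> real"
  assumes "\<And>z. z \<in> T \<Longrightarrow> 0 \<le> p z" "(\<Sum>z\<in>T. p z) \<le> 1"
  shows "(\<Sum>z\<in>T. sqrt (p z)) \<le> sqrt (card T)"
proof -
  have "(\<Sum>z\<in>T. 1 * sqrt (p z))\<^sup>2 \<le> (\<Sum>z\<in>T. 1\<^sup>2) * (\<Sum>z\<in>T. (sqrt (p z))\<^sup>2)"
    by (rule Cauchy_Schwarz_ineq_sum)
  also have "(\<Sum>z\<in>T. (sqrt (p z))\<^sup>2) = (\<Sum>z\<in>T. p z)"
    using assms(1) by (intro sum.cong) auto
  also have "(\<Sum>z\<in>T. 1\<^sup>2) * (\<Sum>z\<in>T. p z) \<le> real (card T)"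
    using mult_left_mono[OF assms(2), of "real (card T)"] by simp
  finally show ?thesis by (intro real_le_rsqrt) simp
qed

text \<open>
  Throughout this context \<open>\<Omega>\<close> is the law of \<open>N\<close> independent observations with law \<open>q\<close>.  The value \<open>d\<close>
  only fills the irrelevant coordinates from \<open>N\<close> on.
\<close>

context
  fixes q :: "'z pmf" and N :: nat and d :: 'z and \<Omega> :: "(nat \<Rightarrow> 'z) pmf"
  assumes N: "0 < N"
  defines "\<Omega> \<equiv> Pi_pmf {..<N} d (\<lambda>_. q)"
begin

lemma expectation_component:
  fixes f :: "'z \<Rightarrow> real"
  assumes "i < N"
  shows "measure_pmf.expectation \<Omega> (\<lambda>zs. f (zs i)) = measure_pmf.expectation q f"
proof -
  have "map_pmf (\<lambda>zs. zs i) \<Omega> = q"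
    unfolding \<Omega>_def using assms by (subst Pi_pmf_component) auto
  then have "measure_pmf.expectation q f = measure_pmf.expectation (map_pmf (\<lambda>zs. zs i) \<Omega>) f" by simp
  then show ?thesis by simp
qed

lemma indep_components:
  "prob_space.indep_vars (measure_pmf \<Omega>) (\<lambda>_. borel)
     (\<lambda>i zs. (f :: 'z \<Rightarrow> real) (zs i)) {..<N}"
  unfolding \<Omega>_def
  by (intro prob_space.indep_vars_compose2[OF _ indep_vars_Pi_pmf])
    (auto simp: measure_pmf.prob_space_axioms)

lemma expectation_indicator: "measure_pmf.expectation q (indicator {z} :: _ \<Rightarrow> real) = pmf q z"
  by (simp add: measure_pmf_single)

lemma second_moment_emp_freq:
  "measure_pmf.expectation \<Omega> (\<lambda>zs. (emp_freq N zs z - pmf q z)\<^sup>2) \<le> pmf q z / N"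
proof -
  define W where "W = (\<lambda>x. indicator {z} x - pmf q z :: real)"
  have W_bd: "\<bar>W x\<bar> \<le> 1" for x
    using pmf_le_1[of q z] pmf_nonneg[of q z] by (auto simp: W_def indicator_def)
  have int: "integrable (measure_pmf r) f" if "\<And>x. \<bar>f x\<bar> \<le> 1" for f :: "'b \<Rightarrow> real" and r
    by (rule measure_pmf.integrable_const_bound[where B=1]) (use that in auto)
  have EW: "measure_pmf.expectation q W = 0"
    unfolding W_def by (subst Bochner_Integration.integral_diff)
      (auto simp: measure_pmf_single intro!: int)
  have EW2: "measure_pmf.expectation q (\<lambda>x. (W x)\<^sup>2) \<le> pmf q z"
  proof -
    have "(W x)\<^sup>2 = (1 - 2 * pmf q z) * indicator {z} x + (pmf q z)\<^sup>2" for x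
      by (auto simp: W_def indicator_def power2_eq_square algebra_simps)
    then have "measure_pmf.expectation q (\<lambda>x. (W x)\<^sup>2)
        = (1 - 2 * pmf q z) * measure_pmf.expectation q (indicator {z}) + (pmf q z)\<^sup>2"
      by (simp add: int)
    also have "\<dots> = (1 - 2 * pmf q z) * pmf q z + (pmf q z)\<^sup>2"
      by (simp only: expectation_indicator)
    also have "\<dots> \<le> pmf q z"
      by (simp add: power2_eq_square algebra_simps)
    finally show ?thesis .
  qed
  have WW: "\<bar>W (zs i) * W (zs j)\<bar> \<le> 1" for zs :: "nat \<Rightarrow> 'z" and i j
    using mult_mono[OF W_bd W_bd, of "zs i" "zs j"] by (simp add: abs_mult mult.commute)
  have cross: "measure_pmf.expectation \<Omega> (\<lambda>zs. W (zs i) * W (zs j)) = 0"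
    if ij: "i < N" "j < N" "i \<noteq> j" for i j
  proof -
    have "prob_space.indep_vars (measure_pmf \<Omega>) (\<lambda>_. borel) (\<lambda>i zs. W (zs i)) {i, j}"
      by (rule prob_space.indep_vars_subset[OF measure_pmf.prob_space_axioms indep_components])
        (use ij in auto)
    then have "measure_pmf.expectation \<Omega> (\<lambda>zs. \<Prod>l\<in>{i, j}. W (zs l)) =
        (\<Prod>l\<in>{i, j}. measure_pmf.expectation \<Omega> (\<lambda>zs. W (zs l)))"
      by (intro prob_space.indep_vars_lebesgue_integral[OF measure_pmf.prob_space_axioms] int W_bd) auto
    then show ?thesis
      using ij(3) by (simp add: expectation_component[OF ij(1)] EW)
  qed
  have "measure_pmf.expectation \<Omega> (\<lambda>zs. (\<Sum>i<N. W (zs i))\<^sup>2)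
      = (\<Sum>i<N. \<Sum>j<N. measure_pmf.expectation \<Omega> (\<lambda>zs. W (zs i) * W (zs j)))"
    by (simp add: power2_eq_square sum_product Bochner_Integration.integral_sum int WW)
  also have "\<dots> = (\<Sum>i<N. measure_pmf.expectation \<Omega> (\<lambda>zs. (W (zs i))\<^sup>2))"
  proof (intro sum.cong refl)
    fix i assume i: "i \<in> {..<N}"
    have "(\<Sum>j<N. measure_pmf.expectation \<Omega> (\<lambda>zs. W (zs i) * W (zs j))) =
      (\<Sum>j<N. if i = j then measure_pmf.expectation \<Omega> (\<lambda>zs. (W (zs i))\<^sup>2) else 0)"
      using i cross by (intro sum.cong) (auto simp: power2_eq_square)
    then show "(\<Sum>j<N. measure_pmf.expectation \<Omega> (\<lambda>zs. W (zs i) * W (zs j))) =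
        measure_pmf.expectation \<Omega> (\<lambda>zs. (W (zs i))\<^sup>2)"
      using i by simp
  qed
  also have "\<dots> \<le> real N * pmf q z"
  proof -
    have "measure_pmf.expectation \<Omega> (\<lambda>zs. (W (zs i))\<^sup>2) \<le> pmf q z" if "i \<in> {..<N}" for i
      using expectation_component[of i "\<lambda>x. (W x)\<^sup>2"] EW2 that by simp
    from sum_bounded_above[of "{..<N}", OF this] show ?thesis by simp
  qed
  finally have *: "measure_pmf.expectation \<Omega> (\<lambda>zs. (\<Sum>i<N. W (zs i))\<^sup>2) \<le> real N * pmf q z" .
  have "emp_freq N zs z - pmf q z = (\<Sum>i<N. W (zs i)) / real N" for zs
    using N by (simp add: emp_freq_def W_def sum_subtractf field_simps)
  then have "measure_pmf.expectation \<Omega> (\<lambda>zs. (emp_freq N zs z - pmf q z)\<^sup>2)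
      = measure_pmf.expectation \<Omega> (\<lambda>zs. (\<Sum>i<N. W (zs i))\<^sup>2) / (real N)\<^sup>2"
    by (simp add: power_divide)
  also have "\<dots> \<le> real N * pmf q z / (real N)\<^sup>2"
    using * by (intro divide_right_mono) auto
  also have "\<dots> = pmf q z / real N" using N by (simp add: power2_eq_square)
  finally show ?thesis .
qed

lemma abs_diff_emp_freq_le_1: "\<bar>emp_freq N zs z - pmf q z\<bar> \<le> 1"
proof -
  have "(\<Sum>i<N. indicator {z} (zs i) :: real) \<le> (\<Sum>i<N. 1)"
    by (intro sum_mono) (auto simp: indicator_def)
  then have "emp_freq N zs z \<le> 1" unfolding emp_freq_def using N by simp
  then show ?thesis
    using emp_freq_nonneg[of N zs z] pmf_le_1[of q z] pmf_nonneg[of q z] by linarith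
qed

lemma mean_abs_deviation_emp_freq:
  "measure_pmf.expectation \<Omega> (\<lambda>zs. \<bar>emp_freq N zs z - pmf q z\<bar>) \<le> sqrt (pmf q z / N)"
proof -
  let ?D = "\<lambda>zs. \<bar>emp_freq N zs z - pmf q z\<bar>"
  have D1: "(emp_freq N zs z - pmf q z)\<^sup>2 \<le> 1" for zs
    using abs_diff_emp_freq_le_1[of zs z] by (simp add: abs_square_le_1)
  have i1: "integrable (measure_pmf \<Omega>) ?D"
    by (rule measure_pmf.integrable_const_bound[where B=1]) (auto simp: abs_diff_emp_freq_le_1)
  have i2: "integrable (measure_pmf \<Omega>) (\<lambda>zs. (?D zs)\<^sup>2)"
    by (rule measure_pmf.integrable_const_bound[where B=1]) (auto simp: D1)
  have "(measure_pmf.expectation \<Omega> ?D)\<^sup>2 \<le> measure_pmf.expectation \<Omega> (\<lambda>zs. (?D zs)\<^sup>2)"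
    using measure_pmf.variance_positive[of \<Omega> ?D] measure_pmf.variance_eq[OF i1 i2] by linarith
  also have "\<dots> \<le> pmf q z / N" using second_moment_emp_freq[of z] by simp
  finally show ?thesis by (rule real_le_rsqrt)
qed

lemma mean_total_deviation_emp_freq:
  assumes "finite T"
  shows "measure_pmf.expectation \<Omega> (\<lambda>zs. \<Sum>z\<in>T. \<bar>emp_freq N zs z - pmf q z\<bar>) \<le> sqrt (card T / N)"
proof -
  have "measure_pmf.expectation \<Omega> (\<lambda>zs. \<Sum>z\<in>T. \<bar>emp_freq N zs z - pmf q z\<bar>)
     = (\<Sum>z\<in>T. measure_pmf.expectation \<Omega> (\<lambda>zs. \<bar>emp_freq N zs z - pmf q z\<bar>))"
    by (intro Bochner_Integration.integral_sum measure_pmf.integrable_const_bound[where B=1])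
      (auto simp: abs_diff_emp_freq_le_1)
  also have "\<dots> \<le> (\<Sum>z\<in>T. sqrt (pmf q z / N))"
    by (intro sum_mono mean_abs_deviation_emp_freq)
  also have "\<dots> = (\<Sum>z\<in>T. sqrt (pmf q z)) / sqrt N"
    by (simp add: real_sqrt_divide sum_divide_distrib)
  also have "\<dots> \<le> sqrt (card T) / sqrt N"
  proof (intro divide_right_mono sum_sqrt_le_sqrt_card)
    show "(\<Sum>z\<in>T. pmf q z) \<le> 1"
      using measure_pmf.prob_le_1[of q T] assms by (simp add: measure_measure_pmf_finite)
  qed auto
  finally show ?thesis by (simp add: real_sqrt_divide)
qed

lemma Hoeffding_emp_freq:
  assumes "0 \<le> t"
  shows "measure_pmf.prob \<Omega> {zs. t \<le> \<bar>emp_freq N zs z - pmf q z\<bar>} \<le> 2 * exp (- 2 * real N * t\<^sup>2)"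
proof -
  interpret H: Hoeffding_ineq "measure_pmf \<Omega>" "{..<N}" "\<lambda>i zs. indicator {z} (zs i)" "\<lambda>_. 0" "\<lambda>_. 1"
    "real N * pmf q z"
  proof unfold_locales
    show "prob_space.indep_vars (measure_pmf \<Omega>) (\<lambda>_. borel)
      (\<lambda>i zs. indicator {z} (zs i) :: real) {..<N}"
      by (rule indep_components)
    have "(\<Sum>i<N. measure_pmf.expectation \<Omega> (\<lambda>zs. indicator {z} (zs i))) = (\<Sum>i<N. pmf q z)"
    proof (intro sum.cong refl)
      fix i assume "i \<in> {..<N}"
      then show "measure_pmf.expectation \<Omega> (\<lambda>zs. indicator {z} (zs i)) = pmf q z"
        using expectation_component[of i "indicator {z}"] expectation_indicator by simp
    qed
    then show "real N * pmf q z \<equiv> \<Sum>i<N. measure_pmf.expectation \<Omega> (\<lambda>zs. indicator {z} (zs i))"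
      by simp
  qed (auto simp: indicator_def)
  have "t \<le> \<bar>emp_freq N zs z - pmf q z\<bar> \<longleftrightarrow>
      real N * t \<le> \<bar>(\<Sum>i<N. indicator {z} (zs i)) - real N * pmf q z\<bar>" for zs
  proof -
    have "(\<Sum>i<N. indicator {z} (zs i)) - real N * pmf q z = real N * (emp_freq N zs z - pmf q z)"
      using N by (simp add: emp_freq_def field_simps)
    then show ?thesis using N by (simp add: abs_mult)
  qed
  then have "{zs. t \<le> \<bar>emp_freq N zs z - pmf q z\<bar>} = {zs \<in> space (measure_pmf \<Omega>).
      real N * t \<le> \<bar>(\<Sum>i<N. indicator {z} (zs i)) - real N * pmf q z\<bar>}" by simp
  then have "measure_pmf.prob \<Omega> {zs. t \<le> \<bar>emp_freq N zs z - pmf q z\<bar>}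
      \<le> 2 * exp (- 2 * (real N * t)\<^sup>2 / (\<Sum>i<N. (1 - 0)\<^sup>2))"
    using H.Hoeffding_ineq_abs_ge[of "real N * t"] assms N by simp
  also have "- 2 * (real N * t)\<^sup>2 / (\<Sum>i<N. (1 - 0)\<^sup>2) = - 2 * real N * t\<^sup>2"
    using N by (simp add: power2_eq_square)
  finally show ?thesis .
qed

lemma Hoeffding_emp_freq_Bex:
  assumes "0 \<le> t" "finite T"
  shows "measure_pmf.prob \<Omega> {zs. \<exists>z\<in>T. t \<le> \<bar>emp_freq N zs z - pmf q z\<bar>}
           \<le> 2 * real (card T) * exp (- 2 * real N * t\<^sup>2)"
proof -
  have "{zs. \<exists>z\<in>T. t \<le> \<bar>emp_freq N zs z - pmf q z\<bar>}
      = (\<Union>z\<in>T. {zs. t \<le> \<bar>emp_freq N zs z - pmf q z\<bar>})" by auto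
  then have "measure_pmf.prob \<Omega> {zs. \<exists>z\<in>T. t \<le> \<bar>emp_freq N zs z - pmf q z\<bar>}
      \<le> (\<Sum>z\<in>T. measure_pmf.prob \<Omega> {zs. t \<le> \<bar>emp_freq N zs z - pmf q z\<bar>})"
    using measure_pmf.finite_measure_subadditive_finite[OF assms(2),
        of "\<lambda>z. {zs. t \<le> \<bar>emp_freq N zs z - pmf q z\<bar>}" \<Omega>] by simp
  also have "\<dots> \<le> (\<Sum>z\<in>T. 2 * exp (- 2 * real N * t\<^sup>2))"
    by (intro sum_mono Hoeffding_emp_freq assms)
  finally show ?thesis by simp
qed

end

section \<open>Nearly independent samples\<close>

lemma sum_PiE_lessThan_Suc:
  "(\<Sum>zs\<in>PiE {..<Suc n} (\<lambda>_. T). f zs) = (\<Sum>zs\<in>PiE {..<n} (\<lambda>_. T). \<Sum>z\<in>T. f (zs(n := z)))"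
proof -
  have "(\<Sum>zs\<in>PiE {..<Suc n} (\<lambda>_. T). f zs)
      = (\<Sum>zs\<in>(\<lambda>(z, zs). zs(n := z)) ` (T \<times> PiE {..<n} (\<lambda>_. T)). f zs)"
    by (simp add: lessThan_Suc PiE_insert_eq)
  also have "\<dots> = (\<Sum>(z, zs)\<in>T \<times> PiE {..<n} (\<lambda>_. T). f (zs(n := z)))"
    by (subst sum.reindex) (auto intro!: inj_combinator sum.cong)
  also have "\<dots> = (\<Sum>z\<in>T. \<Sum>zs\<in>PiE {..<n} (\<lambda>_. T). f (zs(n := z)))"
    by (simp add: sum.cartesian_product)
  finally show ?thesis by (simp add: sum.swap[of _ T])
qed

text \<open>
  A sample \<open>Y 0, \<dots>, Y (N - 1)\<close> from the finite set \<open>T\<close> is nearly independent with common law \<open>q\<close> if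
  replacing each observation, jointly with its predecessors, by an independent one with law \<open>q\<close>
  costs at most \<open>b\<close> in total variation.  Total variation is half of the \<open>\<ell>\<^sup>1\<close> distance.  For \<open>n = 0\<close> the
  condition compares the law of \<open>Y 0\<close> with \<open>q\<close>.
\<close>

locale nearly_iid = prob_space M for M :: "'a measure" +
  fixes Y :: "nat \<Rightarrow> 'a \<Rightarrow> 'z" and T :: "'z set" and q :: "'z pmf" and N :: nat and b :: real
  assumes finite_T: "finite T" and N_pos: "0 < N" and set_q: "set_pmf q \<subseteq> T"
    and Y_in: "\<And>i \<omega>. \<omega> \<in> space M \<Longrightarrow> Y i \<omega> \<in> T"
    and Y_events: "\<And>i z. {\<omega> \<in> space M. Y i \<omega> = z} \<in> events"
    and dependence: "\<And>n. n < N \<Longrightarrow> (\<Sum>zs\<in>PiE {..<n} (\<lambda>_. T). \<Sum>z\<in>T.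
        \<bar>prob {\<omega> \<in> space M. (\<forall>i<n. Y i \<omega> = zs i) \<and> Y n \<omega> = z}
          - prob {\<omega> \<in> space M. \<forall>i<n. Y i \<omega> = zs i} * pmf q z\<bar>) \<le> 2 * b"
begin

lemma path_events: "{\<omega> \<in> space M. \<forall>i<n. Y i \<omega> = zs i} \<in> events"
  using sets.sets_Collect_finite_All[of "{..<n}" M "\<lambda>i \<omega>. Y i \<omega> = zs i"] Y_events by auto

lemma sum_pmf_q: "(\<Sum>z\<in>T. pmf q z) = 1"
  using sum_pmf_eq_1[OF finite_T set_q] .

lemma total_variation_from_product:
  "n \<le> N \<Longrightarrow> (\<Sum>zs\<in>PiE {..<n} (\<lambda>_. T). \<bar>prob {\<omega> \<in> space M. \<forall>i<n. Y i \<omega> = zs i}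
      - (\<Prod>i<n. pmf q (zs i))\<bar>) \<le> 2 * real n * b"
proof (induction n)
  case 0
  show ?case by (simp add: prob_space)
next
  case (Suc n)
  let ?w = "\<lambda>zs. prob {\<omega> \<in> space M. \<forall>i<n. Y i \<omega> = zs i}"
  let ?v = "\<lambda>zs z. prob {\<omega> \<in> space M. (\<forall>i<n. Y i \<omega> = zs i) \<and> Y n \<omega> = z}"
  let ?\<pi> = "\<lambda>zs. \<Prod>i<n. pmf q (zs i)"
  have "(\<Sum>zs\<in>PiE {..<Suc n} (\<lambda>_. T). \<bar>prob {\<omega> \<in> space M. \<forall>i<Suc n. Y i \<omega> = zs i}
      - (\<Prod>i<Suc n. pmf q (zs i))\<bar>) = (\<Sum>zs\<in>PiE {..<n} (\<lambda>_. T). \<Sum>z\<in>T. \<bar>?v zs z - ?\<pi> zs * pmf q z\<bar>)"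
    unfolding sum_PiE_lessThan_Suc
  proof (intro sum.cong refl)
    fix zs z
    have "{\<omega> \<in> space M. \<forall>i<Suc n. Y i \<omega> = (zs(n := z)) i}
        = {\<omega> \<in> space M. (\<forall>i<n. Y i \<omega> = zs i) \<and> Y n \<omega> = z}"
      by (auto simp: less_Suc_eq)
    moreover have "(\<Prod>i<n. pmf q ((zs(n := z)) i)) = ?\<pi> zs"
      by (intro prod.cong) auto
    ultimately show "\<bar>prob {\<omega> \<in> space M. \<forall>i<Suc n. Y i \<omega> = (zs(n := z)) i}
        - (\<Prod>i<Suc n. pmf q ((zs(n := z)) i))\<bar> = \<bar>?v zs z - ?\<pi> zs * pmf q z\<bar>"
      by simp
  qed
  also have "\<dots> \<le> (\<Sum>zs\<in>PiE {..<n} (\<lambda>_. T). \<Sum>z\<in>T.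
      \<bar>?v zs z - ?w zs * pmf q z\<bar> + \<bar>?w zs - ?\<pi> zs\<bar> * pmf q z)"
  proof (intro sum_mono)
    fix zs z
    have "?v zs z - ?\<pi> zs * pmf q z = (?v zs z - ?w zs * pmf q z) + (?w zs - ?\<pi> zs) * pmf q z"
      by (simp add: algebra_simps)
    then show "\<bar>?v zs z - ?\<pi> zs * pmf q z\<bar> \<le> \<bar>?v zs z - ?w zs * pmf q z\<bar> + \<bar>?w zs - ?\<pi> zs\<bar> * pmf q z"
      using abs_triangle_ineq[of "?v zs z - ?w zs * pmf q z" "(?w zs - ?\<pi> zs) * pmf q z"]
      by (simp only: abs_mult abs_of_nonneg[OF pmf_nonneg])
  qed
  also have "\<dots> = (\<Sum>zs\<in>PiE {..<n} (\<lambda>_. T). \<Sum>z\<in>T. \<bar>?v zs z - ?w zs * pmf q z\<bar>)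
      + (\<Sum>zs\<in>PiE {..<n} (\<lambda>_. T). \<bar>?w zs - ?\<pi> zs\<bar>)"
    by (simp only: sum.distrib sum_pmf_q sum_distrib_left[symmetric] mult_1_right)
  also have "\<dots> \<le> 2 * b + 2 * real n * b"
    using Suc dependence[of n] by (intro add_mono) auto
  finally show ?case by (simp add: algebra_simps)
qed

text \<open>
  The product law.  Sample paths are encoded in \<open>PiE {..<N} (\<lambda>_. T)\<close>, whose elements are \<open>undefined\<close>
  outside \<open>{..<N}\<close>; the default value of the product law has to agree with that.
\<close>

abbreviation \<Omega> :: "(nat \<Rightarrow> 'z) pmf" where
  "\<Omega> \<equiv> Pi_pmf {..<N} undefined (\<lambda>_. q)"

lemma finite_paths: "finite (PiE {..<N} (\<lambda>_. T))"
  using finite_T by (intro finite_PiE) auto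

lemma set_\<Omega>: "set_pmf \<Omega> \<subseteq> PiE {..<N} (\<lambda>_. T)"
  using set_q by (auto simp: set_Pi_pmf PiE_dflt_def)

lemma expectation_path:
  fixes f :: "(nat \<Rightarrow> 'z) \<Rightarrow> real"
  shows "expectation (\<lambda>\<omega>. f (\<lambda>i\<in>{..<N}. Y i \<omega>))
    = (\<Sum>zs\<in>PiE {..<N} (\<lambda>_. T). f zs * prob {\<omega> \<in> space M. \<forall>i<N. Y i \<omega> = zs i})"
proof -
  let ?E = "\<lambda>zs. {\<omega> \<in> space M. \<forall>i<N. Y i \<omega> = zs i}"
  have "f (\<lambda>i\<in>{..<N}. Y i \<omega>) = (\<Sum>zs\<in>PiE {..<N} (\<lambda>_. T). f zs * indicator (?E zs) \<omega>)"
    if "\<omega> \<in> space M" for \<omega>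
  proof -
    have "(\<Sum>zs\<in>PiE {..<N} (\<lambda>_. T). f zs * indicator (?E zs) \<omega>)
        = (\<Sum>zs\<in>PiE {..<N} (\<lambda>_. T). if zs = (\<lambda>i\<in>{..<N}. Y i \<omega>) then f zs else 0)"
      using that by (intro sum.cong) (auto simp: indicator_def PiE_def extensional_def fun_eq_iff)
    also have "\<dots> = f (\<lambda>i\<in>{..<N}. Y i \<omega>)"
      using that Y_in finite_paths by (subst sum.delta) auto
    finally show ?thesis by simp
  qed
  then have "expectation (\<lambda>\<omega>. f (\<lambda>i\<in>{..<N}. Y i \<omega>))
      = expectation (\<lambda>\<omega>. \<Sum>zs\<in>PiE {..<N} (\<lambda>_. T). f zs * indicator (?E zs) \<omega>)"
    by (intro Bochner_Integration.integral_cong) auto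
  also have "\<dots> = (\<Sum>zs\<in>PiE {..<N} (\<lambda>_. T). expectation (\<lambda>\<omega>. f zs * indicator (?E zs) \<omega>))"
    by (intro Bochner_Integration.integral_sum integrable_mult_right integrable_real_indicator path_events)
      (simp add: emeasure_eq_measure)
  also have "\<dots> = (\<Sum>zs\<in>PiE {..<N} (\<lambda>_. T). f zs * prob (?E zs))"
    by (intro sum.cong refl) (simp add: Int_absorb2)
  finally show ?thesis .
qed

text \<open>
  A functional with values in \<open>[0, c]\<close> loses only \<open>c N b\<close>, not twice as much.  The factor matters for
  the constant in the tail bound.
\<close>

lemma expectation_le_product:
  fixes f :: "(nat \<Rightarrow> 'z) \<Rightarrow> real"
  assumes f: "\<And>zs. zs \<in> PiE {..<N} (\<lambda>_. T) \<Longrightarrow> 0 \<le> f zs \<and> f zs \<le> c"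
  shows "expectation (\<lambda>\<omega>. f (\<lambda>i\<in>{..<N}. Y i \<omega>)) \<le> measure_pmf.expectation \<Omega> f + c * real N * b"
proof -
  let ?P = "PiE {..<N} (\<lambda>_. T)"
  let ?w = "\<lambda>zs. prob {\<omega> \<in> space M. \<forall>i<N. Y i \<omega> = zs i}"
  have \<Omega>: "measure_pmf.expectation \<Omega> g = (\<Sum>zs\<in>?P. g zs * (\<Prod>i<N. pmf q (zs i)))"
    for g :: "_ \<Rightarrow> real"
  proof -
    have "measure_pmf.expectation \<Omega> g = (\<Sum>zs\<in>?P. g zs * pmf \<Omega> zs)"
      using finite_paths set_\<Omega> by (intro integral_measure_pmf_real) auto
    also have "\<dots> = (\<Sum>zs\<in>?P. g zs * (\<Prod>i<N. pmf q (zs i)))"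
      by (intro sum.cong refl arg_cong2[where f = "(*)"] pmf_Pi') (auto simp: PiE_def extensional_def)
    finally show ?thesis .
  qed
  \<comment> \<open>both weights have total mass one, so subtracting \<open>c / 2\<close> from \<open>f\<close> leaves the difference
      of the two integrals unchanged and halves the bound on \<open>f\<close>\<close>
  have w1: "(\<Sum>zs\<in>?P. ?w zs) = 1" using expectation_path[of "\<lambda>_. 1"] by (simp add: prob_space)
  have p1: "(\<Sum>zs\<in>?P. \<Prod>i<N. pmf q (zs i)) = 1" using \<Omega>[of "\<lambda>_. 1"] by simp
  have c: "0 \<le> c"
  proof -
    obtain zs where "zs \<in> set_pmf \<Omega>" using set_pmf_not_empty[of \<Omega>] by blast
    then show ?thesis using f[of zs] set_\<Omega> by auto
  qed
  have "expectation (\<lambda>\<omega>. f (\<lambda>i\<in>{..<N}. Y i \<omega>)) - measure_pmf.expectation \<Omega> f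
      = (\<Sum>zs\<in>?P. f zs * (?w zs - (\<Prod>i<N. pmf q (zs i))))"
    by (simp add: expectation_path \<Omega> algebra_simps sum_subtractf)
  also have "\<dots> = (\<Sum>zs\<in>?P. (f zs - c / 2) * (?w zs - (\<Prod>i<N. pmf q (zs i))))
      + c / 2 * ((\<Sum>zs\<in>?P. ?w zs) - (\<Sum>zs\<in>?P. \<Prod>i<N. pmf q (zs i)))"
    by (simp add: algebra_simps sum_subtractf sum.distrib sum_distrib_left)
  also have "\<dots> = (\<Sum>zs\<in>?P. (f zs - c / 2) * (?w zs - (\<Prod>i<N. pmf q (zs i))))"
    by (simp add: w1 p1)
  also have "\<dots> \<le> (\<Sum>zs\<in>?P. c / 2 * \<bar>?w zs - (\<Prod>i<N. pmf q (zs i))\<bar>)"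
  proof (intro sum_mono)
    fix zs assume "zs \<in> ?P"
    then have "\<bar>f zs - c / 2\<bar> \<le> c / 2" using f[of zs] unfolding abs_le_iff by (simp add: field_simps)
    then have "\<bar>f zs - c / 2\<bar> * \<bar>?w zs - (\<Prod>i<N. pmf q (zs i))\<bar>
        \<le> c / 2 * \<bar>?w zs - (\<Prod>i<N. pmf q (zs i))\<bar>" by (intro mult_right_mono) auto
    then show "(f zs - c / 2) * (?w zs - (\<Prod>i<N. pmf q (zs i)))
        \<le> c / 2 * \<bar>?w zs - (\<Prod>i<N. pmf q (zs i))\<bar>"
      using abs_ge_self[of "(f zs - c / 2) * (?w zs - (\<Prod>i<N. pmf q (zs i)))"]
      unfolding abs_mult by (rule order_trans[rotated])
  qed
  also have "\<dots> \<le> c / 2 * (2 * real N * b)"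
    unfolding sum_distrib_left[symmetric]
    using total_variation_from_product[of N] c by (intro mult_left_mono) auto
  finally show ?thesis by simp
qed

lemma mean_total_deviation:
  "expectation (\<lambda>\<omega>. \<Sum>z\<in>T. \<bar>emp_freq N (\<lambda>i. Y i \<omega>) z - pmf q z\<bar>)
     \<le> sqrt (card T / N) + 2 * real N * b"
proof -
  let ?f = "\<lambda>zs. \<Sum>z\<in>T. \<bar>emp_freq N zs z - pmf q z\<bar>"
  have "expectation (\<lambda>\<omega>. ?f (\<lambda>i. Y i \<omega>)) = expectation (\<lambda>\<omega>. ?f (\<lambda>i\<in>{..<N}. Y i \<omega>))"
  proof (intro Bochner_Integration.integral_cong refl sum.cong)
    fix \<omega> z
    show "\<bar>emp_freq N (\<lambda>i. Y i \<omega>) z - pmf q z\<bar>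
        = \<bar>emp_freq N (\<lambda>i\<in>{..<N}. Y i \<omega>) z - pmf q z\<bar>"
      by (subst emp_freq_cong[of N _ "\<lambda>i\<in>{..<N}. Y i \<omega>"]) auto
  qed
  also have "\<dots> \<le> measure_pmf.expectation \<Omega> ?f + 2 * real N * b"
    using finite_T N_pos sum_pmf_q
    by (intro expectation_le_product conjI sum_nonneg sum_abs_diff_emp_freq_le_2) auto
  also have "measure_pmf.expectation \<Omega> ?f \<le> sqrt (card T / N)"
    by (rule mean_total_deviation_emp_freq[OF N_pos finite_T])
  finally show ?thesis by simp
qed

lemma tail_max_deviation:
  assumes "0 \<le> t"
  shows "prob {\<omega> \<in> space M. \<exists>z\<in>T. t \<le> \<bar>emp_freq N (\<lambda>i. Y i \<omega>) z - pmf q z\<bar>}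
     \<le> real N * b + 2 * real (card T) * exp (- 2 * real N * t\<^sup>2)"
proof -
  let ?B = "{zs. \<exists>z\<in>T. t \<le> \<bar>emp_freq N zs z - pmf q z\<bar>}"
  let ?E = "{\<omega> \<in> space M. \<exists>z\<in>T. t \<le> \<bar>emp_freq N (\<lambda>i. Y i \<omega>) z - pmf q z\<bar>}"
  have "prob ?E = expectation (indicator ?E)"
    by (simp add: Int_absorb2)
  also have "\<dots> = expectation (\<lambda>\<omega>. indicator ?B (\<lambda>i\<in>{..<N}. Y i \<omega>))"
  proof (intro Bochner_Integration.integral_cong refl)
    fix \<omega> assume "\<omega> \<in> space M"
    have "emp_freq N (\<lambda>i. Y i \<omega>) z = emp_freq N (\<lambda>i\<in>{..<N}. Y i \<omega>) z" for z
      by (rule emp_freq_cong) auto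
    then show "indicator ?E \<omega> = (indicator ?B (\<lambda>i\<in>{..<N}. Y i \<omega>) :: real)"
      using \<open>\<omega> \<in> space M\<close> by (simp add: indicator_def)
  qed
  also have "\<dots> \<le> measure_pmf.expectation \<Omega> (indicator ?B) + 1 * real N * b"
    by (intro expectation_le_product) (auto simp: indicator_def)
  also have "\<dots> \<le> real N * b + 2 * real (card T) * exp (- 2 * real N * t\<^sup>2)"
    using Hoeffding_emp_freq_Bex[OF N_pos assms finite_T, of undefined q] by simp
  finally show ?thesis .
qed

end

section \<open>Stationary Markov chains with finitely many states\<close>

lemma finite_pmf_exists:
  fixes p :: "'z \<Rightarrow> real"
  assumes "finite T" "\<And>z. z \<in> T \<Longrightarrow> 0 \<le> p z" "(\<Sum>z\<in>T. p z) = 1"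
  obtains q where "set_pmf q \<subseteq> T" "\<And>z. z \<in> T \<Longrightarrow> pmf q z = p z"
proof -
  let ?p = "\<lambda>z. if z \<in> T then p z else 0"
  let ?q = "embed_pmf ?p"
  have "(\<integral>\<^sup>+ z. ennreal (?p z) \<partial>count_space UNIV) = (\<Sum>z\<in>T. ennreal (?p z))"
    using assms(1) by (intro nn_integral_count_space') (auto split: if_splits)
  also have "\<dots> = 1"
    using assms by (simp add: sum_ennreal)
  finally have q: "pmf ?q z = ?p z" for z
    using assms(2) by (intro pmf_embed_pmf) auto
  have "set_pmf ?q \<subseteq> T" by (auto simp: set_pmf_iff q split: if_splits)
  then show ?thesis by (rule that) (simp add: q)
qed

locale stationary_markov_chain = prob_space M for M :: "'a measure" +
  fixes X :: "nat \<Rightarrow> 'a \<Rightarrow> real" and S :: "real set"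
  assumes X_measurable [measurable]: "\<And>t. X t \<in> borel_measurable M"
    and finite_S: "finite S" and X_in: "\<And>t \<omega>. \<omega> \<in> space M \<Longrightarrow> X t \<omega> \<in> S"
    and stationary: "stationary_process M X" and markov: "markov_process M X"
begin

text \<open>
  The stationary law \<open>\<pi>\<close>, the joint law \<open>J g\<close> of two observations at distance \<open>g\<close>, and the \<open>g\<close>-step
  transition probabilities \<open>K g\<close>.  Division by zero makes \<open>K g u\<close> vanish for states \<open>u\<close> of probability
  zero, so the rows of \<open>K g\<close> are substochastic.
\<close>

definition \<pi> :: "real \<Rightarrow> real" where
  "\<pi> u = prob {\<omega> \<in> space M. X 0 \<omega> = u}"

definition J :: "nat \<Rightarrow> real \<Rightarrow> real \<Rightarrow> real" where
  "J g u v = prob {\<omega> \<in> space M. X 0 \<omega> = u \<and> X g \<omega> = v}"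

definition K :: "nat \<Rightarrow> real \<Rightarrow> real \<Rightarrow> real" where
  "K g u v = J g u v / \<pi> u"

lemma \<pi>_nonneg [simp]: "0 \<le> \<pi> u" and J_nonneg [simp]: "0 \<le> J g u v" and K_nonneg [simp]: "0 \<le> K g u v"
  by (simp_all add: \<pi>_def J_def K_def)

lemma \<pi>_K: "\<pi> u * K g u v = J g u v"
proof (cases "\<pi> u = 0")
  case True
  have "J g u v \<le> \<pi> u" unfolding \<pi>_def J_def by (intro finite_measure_mono) auto
  then show ?thesis using True J_nonneg[of g u v] by simp
qed (simp add: K_def)

lemma prob_pair_shift: "prob {\<omega> \<in> space M. X s \<omega> = u \<and> X (s + g) \<omega> = v} = J g u v"
proof -
  \<comment> \<open>both probabilities are the measure of the cylinder \<open>?E\<close> under the law of a shifted process\<close>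
  let ?E = "{f \<in> space (\<Pi>\<^sub>M t\<in>(UNIV::nat set). borel). f 0 = u \<and> f g = v} :: (nat \<Rightarrow> real) set"
  have E: "?E \<in> sets (\<Pi>\<^sub>M t\<in>UNIV. borel)" by measurable
  have *: "prob {\<omega> \<in> space M. X s \<omega> = u \<and> X (s + g) \<omega> = v}
      = measure (distr M (\<Pi>\<^sub>M t\<in>UNIV. borel) (\<lambda>\<omega> t. X (s + t) \<omega>)) ?E" for s
  proof -
    have "(\<lambda>\<omega> t. X (s + t) \<omega>) \<in> measurable M (\<Pi>\<^sub>M t\<in>UNIV. borel)"
      by (rule measurable_PiM_single') (auto simp: space_PiM)
    then show ?thesis
      using E by (subst measure_distr) (auto simp: space_PiM intro!: arg_cong[where f = prob])
  qed
  have "distr M (\<Pi>\<^sub>M t\<in>UNIV. borel) (\<lambda>\<omega> t. X (s + t) \<omega>)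
      = distr M (\<Pi>\<^sub>M t\<in>UNIV. borel) (\<lambda>\<omega> t. X t \<omega>)"
    using stationary unfolding stationary_process_def by blast
  then show ?thesis using *[of s] *[of 0] by (simp add: J_def)
qed

lemma prob_shift: "prob {\<omega> \<in> space M. X s \<omega> = u} = \<pi> u"
  using prob_pair_shift[of s u 0 u] by (simp add: J_def \<pi>_def)

lemma prob_sum_values:
  assumes "A \<in> events"
  shows "(\<Sum>u\<in>S. prob {\<omega> \<in> A. X t \<omega> = u}) = prob A"
proof -
  have "(\<Sum>u\<in>S. prob {\<omega> \<in> A. X t \<omega> = u}) = prob (\<Union>u\<in>S. {\<omega> \<in> A. X t \<omega> = u})"
  proof (rule finite_measure_finite_Union[symmetric])
    show "(\<lambda>u. {\<omega> \<in> A. X t \<omega> = u}) ` S \<subseteq> events"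
    proof (rule image_subsetI)
      fix u
      have "{\<omega> \<in> A. X t \<omega> = u} = A \<inter> {\<omega> \<in> space M. X t \<omega> = u}"
        using assms sets.sets_into_space by blast
      also have "\<dots> \<in> events" using assms by measurable
      finally show "{\<omega> \<in> A. X t \<omega> = u} \<in> events" .
    qed
  qed (auto simp: disjoint_family_on_def finite_S)
  also have "(\<Union>u\<in>S. {\<omega> \<in> A. X t \<omega> = u}) = A"
    using assms sets.sets_into_space X_in by blast
  finally show ?thesis .
qed

lemma sum_\<pi>: "(\<Sum>u\<in>S. \<pi> u) = 1"
  using prob_sum_values[of "space M" 0] by (simp add: \<pi>_def prob_space)

lemma sum_J: "(\<Sum>v\<in>S. J g u v) = \<pi> u"
  using prob_sum_values[of "{\<omega> \<in> space M. X 0 \<omega> = u}" g] by (simp add: \<pi>_def J_def)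

lemma sum_K_le_1: "(\<Sum>v\<in>S. K g u v) \<le> 1"
  by (simp add: K_def sum_J flip: sum_divide_distrib)

text \<open>
  \<open>past s A\<close> says that \<open>A\<close> is an event determined by \<open>X 0, \<dots>, X s\<close>: membership of an outcome depends
  only on its path up to time \<open>s\<close>.  Measurability of \<open>A\<close> then follows, because there are only finitely many
  such paths (\<open>past_paths\<close>, \<open>past_events\<close>).
\<close>

definition past :: "nat \<Rightarrow> 'a set \<Rightarrow> bool" where
  "past s A \<longleftrightarrow> A \<subseteq> space M \<and> (\<forall>\<omega>\<in>space M. \<forall>\<omega>'\<in>space M.
     (\<forall>i\<le>s. X i \<omega> = X i \<omega>') \<longrightarrow> \<omega> \<in> A \<longrightarrow> \<omega>' \<in> A)"

abbreviation path :: "nat \<Rightarrow> (nat \<Rightarrow> real) \<Rightarrow> 'a set" where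
  "path s a \<equiv> {\<omega> \<in> space M. \<forall>i\<le>s. X i \<omega> = a i}"

lemma past_mono:
  assumes "past s A" "s \<le> t"
  shows "past t A"
  unfolding past_def
proof (intro conjI ballI impI)
  show "A \<subseteq> space M" using assms(1) unfolding past_def by blast
  fix \<omega> \<omega>' assume *: "\<omega> \<in> space M" "\<omega>' \<in> space M" "\<forall>i\<le>t. X i \<omega> = X i \<omega>'" "\<omega> \<in> A"
  then have "\<forall>i\<le>s. X i \<omega> = X i \<omega>'" using assms(2) order_trans by blast
  then show "\<omega>' \<in> A" using assms(1) * unfolding past_def by blast
qed

lemma past_Collect:
  assumes "\<And>\<omega> \<omega>'. (\<And>i. i \<le> s \<Longrightarrow> X i \<omega> = X i \<omega>') \<Longrightarrow> P \<omega> \<Longrightarrow> P \<omega>'"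
  shows "past s {\<omega> \<in> space M. P \<omega>}"
  unfolding past_def by (auto intro: assms)

lemma past_value:
  assumes "past s A" "t \<le> s"
  shows "past s {\<omega> \<in> A. X t \<omega> = x}"
  unfolding past_def
proof (intro conjI ballI impI)
  show "{\<omega> \<in> A. X t \<omega> = x} \<subseteq> space M" using assms(1) by (auto simp: past_def)
  fix \<omega> \<omega>' assume *: "\<omega> \<in> space M" "\<omega>' \<in> space M" "\<forall>i\<le>s. X i \<omega> = X i \<omega>'" "\<omega> \<in> {\<omega> \<in> A. X t \<omega> = x}"
  then have "\<omega>' \<in> A" using assms(1) unfolding past_def by blast
  moreover have "X t \<omega>' = x" using * assms(2) by simp
  ultimately show "\<omega>' \<in> {\<omega> \<in> A. X t \<omega> = x}" by simp
qed

lemma past_paths: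
  assumes "past s A"
  obtains I where "finite I" "\<And>a. a \<in> I \<Longrightarrow> path s a \<subseteq> A \<and> path s a \<noteq> {}" "A = (\<Union>a\<in>I. path s a)"
    "disjoint_family_on (path s) I"
proof -
  define I where "I = {a \<in> PiE {..s} (\<lambda>_. S). path s a \<subseteq> A \<and> path s a \<noteq> {}}"
  have "finite (PiE {..s} (\<lambda>_. S))" using finite_S by (intro finite_PiE) auto
  then have "finite I" by (simp add: I_def)
  moreover have "A = (\<Union>a\<in>I. path s a)"
  proof
    show "A \<subseteq> (\<Union>a\<in>I. path s a)"
    proof
      fix \<omega> assume "\<omega> \<in> A"
      then have sp: "\<omega> \<in> space M" using assms by (auto simp: past_def)
      let ?a = "\<lambda>i\<in>{..s}. X i \<omega>"
      have "?a \<in> PiE {..s} (\<lambda>_. S)" using X_in[OF sp] by auto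
      moreover have w: "\<omega> \<in> path s ?a" using sp by simp
      moreover have "path s ?a \<subseteq> A"
      proof
        fix \<omega>' assume "\<omega>' \<in> path s ?a"
        then have "\<omega>' \<in> space M" "\<forall>i\<le>s. X i \<omega> = X i \<omega>'" by auto
        then show "\<omega>' \<in> A" using assms sp \<open>\<omega> \<in> A\<close> unfolding past_def by blast
      qed
      ultimately have "?a \<in> I" by (auto simp: I_def)
      with w show "\<omega> \<in> (\<Union>a\<in>I. path s a)" by blast
    qed
  qed (auto simp: I_def)
  moreover have "disjoint_family_on (path s) I"
  proof (unfold disjoint_family_on_def, intro ballI impI)
    fix a b assume "a \<in> I" "b \<in> I" "a \<noteq> b"
    then obtain i where "i \<le> s" "a i \<noteq> b i"
      by (metis (no_types, lifting) I_def PiE_ext atMost_iff mem_Collect_eq)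
    then show "path s a \<inter> path s b = {}" by auto
  qed
  moreover have "\<And>a. a \<in> I \<Longrightarrow> path s a \<subseteq> A \<and> path s a \<noteq> {}" unfolding I_def by blast
  ultimately show ?thesis by (intro that[of I])
qed

lemma path_events: "path s a \<in> events"
  by measurable

lemma past_events: "past s A \<Longrightarrow> A \<in> events"
  by (erule past_paths) (auto intro!: sets.finite_UN path_events)

lemma one_step_path:
  "prob {\<omega> \<in> path s a. X (Suc s) \<omega> = y} = prob (path s a) * K 1 (a s) y"
proof (cases "prob (path s a) > 0")
  case True
  have "\<P>(\<omega> in M. X (Suc s) \<omega> = y \<bar> \<forall>i\<le>s. X i \<omega> = a i)
      = \<P>(\<omega> in M. X (Suc s) \<omega> = y \<bar> X s \<omega> = a s)"
    using markov True unfolding markov_process_def by blast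
  also have "\<dots> = K 1 (a s) y"
    using prob_pair_shift[of s "a s" 1 y] prob_shift[of s "a s"]
    by (simp add: cond_prob_def K_def conj_commute)
  finally have "prob {\<omega> \<in> space M. X (Suc s) \<omega> = y \<and> (\<forall>i\<le>s. X i \<omega> = a i)} = prob (path s a) * K 1 (a s) y"
    using True by (simp add: cond_prob_def field_simps)
  moreover have "{\<omega> \<in> path s a. X (Suc s) \<omega> = y}
      = {\<omega> \<in> space M. X (Suc s) \<omega> = y \<and> (\<forall>i\<le>s. X i \<omega> = a i)}" by auto
  ultimately show ?thesis by simp
next
  case False
  then have 0: "prob (path s a) = 0" using measure_nonneg[of M "path s a"] by linarith
  have "prob {\<omega> \<in> path s a. X (Suc s) \<omega> = y} \<le> prob (path s a)"
    by (intro finite_measure_mono path_events) auto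
  then show ?thesis using 0 by (simp add: measure_le_0_iff)
qed

lemma one_step:
  assumes "past s A"
  shows "prob {\<omega> \<in> A. X s \<omega> = x \<and> X (Suc s) \<omega> = y} = prob {\<omega> \<in> A. X s \<omega> = x} * K 1 x y"
proof -
  have "past s {\<omega> \<in> A. X s \<omega> = x}" using past_value[OF assms] by simp
  then obtain I where I: "finite I" "\<And>a. a \<in> I \<Longrightarrow> path s a \<subseteq> {\<omega> \<in> A. X s \<omega> = x} \<and> path s a \<noteq> {}"
    "{\<omega> \<in> A. X s \<omega> = x} = (\<Union>a\<in>I. path s a)" "disjoint_family_on (path s) I"
    by (rule past_paths) blast
  have "{\<omega> \<in> A. X s \<omega> = x \<and> X (Suc s) \<omega> = y} = {\<omega> \<in> {\<omega> \<in> A. X s \<omega> = x}. X (Suc s) \<omega> = y}" by auto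
  also have "\<dots> = (\<Union>a\<in>I. {\<omega> \<in> path s a. X (Suc s) \<omega> = y})" unfolding I(3) by auto
  also have "prob \<dots> = (\<Sum>a\<in>I. prob {\<omega> \<in> path s a. X (Suc s) \<omega> = y})"
    using I(1,4) by (intro finite_measure_finite_Union) (auto simp: disjoint_family_on_def)
  also have "\<dots> = (\<Sum>a\<in>I. prob (path s a) * K 1 x y)"
  proof (intro sum.cong refl)
    fix a assume "a \<in> I"
    then have "a s = x" using I(2)[of a] by auto
    then show "prob {\<omega> \<in> path s a. X (Suc s) \<omega> = y} = prob (path s a) * K 1 x y"
      using one_step_path[of s a y] by simp
  qed
  also have "\<dots> = prob (\<Union>a\<in>I. path s a) * K 1 x y"
    using I(1,4) path_events
    by (subst finite_measure_finite_Union) (auto simp: sum_distrib_right)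
  finally show ?thesis by (simp add: I(3))
qed

text \<open>
  The Markov property for arbitrary past events and \<open>g\<close> steps.  The Chapman--Kolmogorov equation for
  \<open>K\<close> is obtained inside the induction by taking the whole space as past event.
\<close>

lemma multi_step:
  "past s A \<Longrightarrow> prob {\<omega> \<in> A. X s \<omega> = x \<and> X (s + g) \<omega> = y} = prob {\<omega> \<in> A. X s \<omega> = x} * K g x y"
proof (induction g arbitrary: y)
  case 0
  show ?case
  proof (cases "\<pi> x = 0")
    case True
    have "prob {\<omega> \<in> A. X s \<omega> = x} \<le> prob {\<omega> \<in> space M. X s \<omega> = x}"
      using 0 by (intro finite_measure_mono) (auto simp: past_def)
    then have z: "prob {\<omega> \<in> A. X s \<omega> = x} = 0" using True by (simp add: prob_shift measure_le_0_iff)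
    have "prob {\<omega> \<in> A. X s \<omega> = x \<and> X (s + 0) \<omega> = y} \<le> prob {\<omega> \<in> A. X s \<omega> = x}"
      using past_events[OF past_value[OF 0, of s]] by (intro finite_measure_mono) auto
    then show ?thesis using z by (simp add: measure_le_0_iff)
  next
    case False
    show ?thesis
    proof (cases "x = y")
      case True
      have "J 0 x x = \<pi> x" by (simp add: J_def \<pi>_def)
      then show ?thesis using True False by (simp add: K_def)
    next
      case f: False
      then have "{\<omega> \<in> A. X s \<omega> = x \<and> X (s + 0) \<omega> = y} = {}" by auto
      moreover have "K 0 x y = 0"
      proof -
        have "{\<omega> \<in> space M. X 0 \<omega> = x \<and> X 0 \<omega> = y} = {}" using f by auto
        then have "J 0 x y = 0" by (simp only: J_def measure_empty)
        then show ?thesis by (simp add: K_def)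
      qed
      ultimately show ?thesis by (simp only: measure_empty mult_zero_right)
    qed
  qed
next
  case (Suc g)
  have step: "prob {\<omega> \<in> B. X t \<omega> = x \<and> X (t + Suc g) \<omega> = y}
      = (\<Sum>w\<in>S. prob {\<omega> \<in> B. X t \<omega> = x \<and> X (t + g) \<omega> = w} * K 1 w y)"
    if B: "past t B" for t B
  proof -
    let ?C = "{\<omega> \<in> B. X t \<omega> = x}"
    have C: "past (t + g) ?C" using past_value[OF past_mono[OF B]] by simp
    have ev: "{\<omega> \<in> ?C. X (t + Suc g) \<omega> = y} \<in> events"
      using past_events[OF past_value[OF past_mono[OF C], of "t + Suc g" "t + Suc g" y]] by simp
    have "prob {\<omega> \<in> B. X t \<omega> = x \<and> X (t + Suc g) \<omega> = y}
        = (\<Sum>w\<in>S. prob {\<omega> \<in> {\<omega> \<in> ?C. X (t + Suc g) \<omega> = y}. X (t + g) \<omega> = w})"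
      using prob_sum_values[OF ev, of "t + g"] by (simp add: conj_assoc)
    also have "\<dots> = (\<Sum>w\<in>S. prob {\<omega> \<in> ?C. X (t + g) \<omega> = w \<and> X (Suc (t + g)) \<omega> = y})"
      by (intro sum.cong refl arg_cong[where f = prob]) auto
    also have "\<dots> = (\<Sum>w\<in>S. prob {\<omega> \<in> ?C. X (t + g) \<omega> = w} * K 1 w y)"
      by (simp only: one_step[OF C])
    finally show ?thesis by (simp add: conj_assoc)
  qed
  have 1: "prob {\<omega> \<in> A. X s \<omega> = x \<and> X (s + Suc g) \<omega> = y}
      = prob {\<omega> \<in> A. X s \<omega> = x} * (\<Sum>w\<in>S. K g x w * K 1 w y)"
    unfolding step[OF Suc.prems] Suc.IH[OF Suc.prems] by (simp add: sum_distrib_left mult.assoc)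
  have full: "past 0 (space M)" by (auto simp: past_def)
  \<comment> \<open>the same recursion from time 0, where the past event is trivial, identifies the sum as \<open>K (Suc g) x y\<close>\<close>
  have 2: "J (Suc g) x y = \<pi> x * (\<Sum>w\<in>S. K g x w * K 1 w y)"
  proof -
    have "J g x w = \<pi> x * K g x w" for w by (simp add: \<pi>_K)
    then show ?thesis
      using step[OF full] by (simp add: J_def sum_distrib_left mult.assoc)
  qed
  show ?case
  proof (cases "\<pi> x = 0")
    case True
    have "prob {\<omega> \<in> A. X s \<omega> = x} \<le> prob {\<omega> \<in> space M. X s \<omega> = x}"
      using Suc.prems by (intro finite_measure_mono) (auto simp: past_def)
    then have "prob {\<omega> \<in> A. X s \<omega> = x} = 0" using True by (simp add: prob_shift measure_le_0_iff)
    then show ?thesis using 1 by simp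
  next
    case False
    then have "K (Suc g) x y = (\<Sum>w\<in>S. K g x w * K 1 w y)" using 2 by (simp add: K_def)
    then show ?thesis using 1 by simp
  qed
qed

abbreviation \<beta> :: "nat \<Rightarrow> real" where
  "\<beta> \<equiv> beta_coeff M X S"

lemma beta_eq: "\<beta> g = 1 / 2 * (\<Sum>u\<in>S. \<Sum>v\<in>S. \<bar>J g u v - \<pi> u * \<pi> v\<bar>)"
proof -
  have 1: "measure (distr M (borel \<Otimes>\<^sub>M borel) (\<lambda>\<omega>. (X 0 \<omega>, X g \<omega>))) {(u, v)} = J g u v" for u v
  proof -
    have "{(u, v)} \<in> sets (borel \<Otimes>\<^sub>M borel :: (real \<times> real) measure)" 
      using pair_measureI[of "{u}" borel "{v}" borel] by simp
    then show ?thesis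
      unfolding J_def by (subst measure_distr) (auto intro!: arg_cong[where f = prob])
  qed
  have 2: "measure (distr M borel (X 0)) {u} = \<pi> u" for u
    unfolding \<pi>_def by (subst measure_distr) (auto intro!: arg_cong[where f = prob])
  show ?thesis by (simp add: beta_coeff_def 1 2)
qed

text \<open>
  Given a past event, the law of \<open>X (s + g)\<close> is a mixture of the rows of \<open>K g\<close>.  The weights of the
  mixtures, summed over disjoint past events, are at most \<open>\<pi>\<close>, which leaves the sum that defines
  \<open>2 \<beta> g\<close>.
\<close>

lemma mixing_past_events:
  assumes "finite I" "disjoint_family_on A I" "\<And>i. i \<in> I \<Longrightarrow> past s (A i)"
  shows "(\<Sum>i\<in>I. \<Sum>u\<in>S. \<bar>prob {\<omega> \<in> A i. X (s + g) \<omega> = u} - prob (A i) * \<pi> u\<bar>) \<le> 2 * \<beta> g"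
proof -
  let ?p = "\<lambda>i x. prob {\<omega> \<in> A i. X s \<omega> = x}"
  have "(\<Sum>i\<in>I. \<Sum>u\<in>S. \<bar>prob {\<omega> \<in> A i. X (s + g) \<omega> = u} - prob (A i) * \<pi> u\<bar>)
      \<le> (\<Sum>i\<in>I. \<Sum>u\<in>S. \<Sum>x\<in>S. ?p i x * \<bar>K g x u - \<pi> u\<bar>)"
  proof (intro sum_mono)
    fix i u assume i: "i \<in> I"
    note Ai = assms(3)[OF i]
    have "{\<omega> \<in> A i. X (s + g) \<omega> = u} \<in> events"
      by (rule past_events[OF past_value[OF past_mono[OF Ai]], of "s + g"]) auto
    from prob_sum_values[OF this, of s]
    have "prob {\<omega> \<in> A i. X (s + g) \<omega> = u}
        = (\<Sum>x\<in>S. prob {\<omega> \<in> {\<omega> \<in> A i. X (s + g) \<omega> = u}. X s \<omega> = x})" by (rule sym)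
    also have "\<dots> = (\<Sum>x\<in>S. prob {\<omega> \<in> A i. X s \<omega> = x \<and> X (s + g) \<omega> = u})"
      by (intro sum.cong refl arg_cong[where f = prob]) auto
    also have "\<dots> = (\<Sum>x\<in>S. ?p i x * K g x u)" by (simp only: multi_step[OF Ai])
    finally have "prob {\<omega> \<in> A i. X (s + g) \<omega> = u} - prob (A i) * \<pi> u
        = (\<Sum>x\<in>S. ?p i x * (K g x u - \<pi> u))"
      by (simp add: prob_sum_values[OF past_events[OF Ai], of s, symmetric] sum_distrib_right
          sum_subtractf right_diff_distrib)
    also have "\<bar>\<dots>\<bar> \<le> (\<Sum>x\<in>S. \<bar>?p i x * (K g x u - \<pi> u)\<bar>)" by (rule sum_abs)
    finally show "\<bar>prob {\<omega> \<in> A i. X (s + g) \<omega> = u} - prob (A i) * \<pi> u\<bar>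
        \<le> (\<Sum>x\<in>S. ?p i x * \<bar>K g x u - \<pi> u\<bar>)" by (simp add: abs_mult)
  qed
  also have "\<dots> = (\<Sum>u\<in>S. \<Sum>x\<in>S. \<Sum>i\<in>I. ?p i x * \<bar>K g x u - \<pi> u\<bar>)"
    by (subst sum.swap, subst sum.swap[of _ I]) (rule refl)
  also have "\<dots> = (\<Sum>x\<in>S. \<Sum>u\<in>S. (\<Sum>i\<in>I. ?p i x) * \<bar>K g x u - \<pi> u\<bar>)"
    by (subst sum.swap) (simp add: sum_distrib_right)
  also have "\<dots> \<le> (\<Sum>x\<in>S. \<Sum>u\<in>S. \<bar>J g x u - \<pi> x * \<pi> u\<bar>)"
  proof (intro sum_mono)
    fix x u
    have "(\<Sum>i\<in>I. ?p i x) = prob (\<Union>i\<in>I. {\<omega> \<in> A i. X s \<omega> = x})"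
      using assms past_events[OF past_value[OF assms(3)]]
      by (intro finite_measure_finite_Union[symmetric]) (auto simp: disjoint_family_on_def)
    also have "\<dots> \<le> prob {\<omega> \<in> space M. X s \<omega> = x}"
      using assms(3) by (intro finite_measure_mono) (auto simp: past_def)
    finally have "(\<Sum>i\<in>I. ?p i x) \<le> \<pi> x" by (simp add: prob_shift)
    then have "(\<Sum>i\<in>I. ?p i x) * \<bar>K g x u - \<pi> u\<bar> \<le> \<pi> x * \<bar>K g x u - \<pi> u\<bar>"
      by (rule mult_right_mono) simp
    also have "\<dots> = \<bar>J g x u - \<pi> x * \<pi> u\<bar>"
      by (simp add: abs_mult[of "\<pi> x", symmetric, simplified] right_diff_distrib \<pi>_K)
    finally show "(\<Sum>i\<in>I. ?p i x) * \<bar>K g x u - \<pi> u\<bar> \<le> \<bar>J g x u - \<pi> x * \<pi> u\<bar>" .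
  qed
  finally show ?thesis by (simp add: beta_eq)
qed

lemma beta_nonneg: "0 \<le> \<beta> g"
  unfolding beta_eq by (intro mult_nonneg_nonneg sum_nonneg) auto

lemma disjoint_PiE_paths:
  "disjoint_family_on (\<lambda>zs. {\<omega> \<in> space M. \<forall>i<n. Y i \<omega> = zs i}) (PiE {..<n} (\<lambda>_. T))"
proof (unfold disjoint_family_on_def, intro ballI impI)
  fix a b assume "a \<in> PiE {..<n} (\<lambda>_. T)" "b \<in> PiE {..<n} (\<lambda>_. T)" "a \<noteq> b"
  then obtain i where "i < n" "a i \<noteq> b i" by (metis PiE_ext lessThan_iff)
  then show "{\<omega> \<in> space M. \<forall>i<n. Y i \<omega> = a i} \<inter> {\<omega> \<in> space M. \<forall>i<n. Y i \<omega> = b i} = {}" by auto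
qed

lemma nearly_iid_marginal:
  assumes q: "set_pmf q \<subseteq> S" "\<And>u. u \<in> S \<Longrightarrow> pmf q u = \<pi> u" and "0 < N"
  shows "nearly_iid M (\<lambda>i. X (s0 + i * L)) S q N (\<beta> L)"
proof unfold_locales
  fix n assume "n < N"
  let ?A = "\<lambda>zs. {\<omega> \<in> space M. \<forall>i<n. X (s0 + i * L) \<omega> = zs i}"
  show "(\<Sum>zs\<in>PiE {..<n} (\<lambda>_. S). \<Sum>z\<in>S.
      \<bar>prob {\<omega> \<in> space M. (\<forall>i<n. X (s0 + i * L) \<omega> = zs i) \<and> X (s0 + n * L) \<omega> = z}
        - prob (?A zs) * pmf q z\<bar>) \<le> 2 * \<beta> L"
  proof (cases n)
    case 0
    then show ?thesis by (simp add: prob_shift q(2) prob_space beta_nonneg)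
  next
    case (Suc n')
    have "(\<Sum>zs\<in>PiE {..<n} (\<lambda>_. S). \<Sum>z\<in>S.
        \<bar>prob {\<omega> \<in> ?A zs. X ((s0 + n' * L) + L) \<omega> = z} - prob (?A zs) * \<pi> z\<bar>) \<le> 2 * \<beta> L"
    proof (rule mixing_past_events)
      show "past (s0 + n' * L) (?A zs)" for zs
      proof (rule past_Collect)
        fix \<omega> \<omega>' assume eq: "\<And>i. i \<le> s0 + n' * L \<Longrightarrow> X i \<omega> = X i \<omega>'"
          and *: "\<forall>i<n. X (s0 + i * L) \<omega> = zs i"
        show "\<forall>i<n. X (s0 + i * L) \<omega>' = zs i"
          using eq * Suc by (metis add_left_mono less_Suc_eq_le mult_le_mono1)
      qed
    qed (use finite_S disjoint_PiE_paths in \<open>auto intro!: finite_PiE\<close>)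
    moreover have "(s0 + n' * L) + L = s0 + n * L" using Suc by simp
    ultimately show ?thesis by (simp add: q(2) conj_assoc)
  qed
qed (use assms(1,3) finite_S X_in in simp_all)

text \<open>
  Within a pair, the second observation depends on the past through the first only, so that the
  distance of the laws of pairs reduces to the distance of the laws of their first components, at
  distance \<open>L - m\<close> from the last observed time.
\<close>

lemma nearly_iid_pair:
  assumes q: "set_pmf q \<subseteq> S \<times> S" "\<And>u v. u \<in> S \<Longrightarrow> v \<in> S \<Longrightarrow> pmf q (u, v) = J m u v"
    and "0 < N" "m \<le> L"
  shows "nearly_iid M (\<lambda>i \<omega>. (X (i * L) \<omega>, X (i * L + m) \<omega>)) (S \<times> S) q N (\<beta> (L - m))"
proof unfold_locales
  let ?Z = "\<lambda>i \<omega>. (X (i * L) \<omega>, X (i * L + m) \<omega>)"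
  show "{\<omega> \<in> space M. ?Z i \<omega> = z} \<in> events" for i z
    by (cases z) simp
  fix n assume "n < N"
  let ?A = "\<lambda>zs. {\<omega> \<in> space M. \<forall>i<n. ?Z i \<omega> = zs i}"
  have *: "(\<Sum>zs\<in>PiE {..<n} (\<lambda>_. S \<times> S). \<Sum>u\<in>S. \<bar>prob {\<omega> \<in> ?A zs. X (n * L) \<omega> = u} - prob (?A zs) * \<pi> u\<bar>)
      \<le> 2 * \<beta> (L - m) \<and> (\<forall>zs. past (n * L) (?A zs))"
  proof (cases n)
    case 0
    then show ?thesis by (auto simp: prob_shift prob_space beta_nonneg past_def)
  next
    case (Suc n')
    have past: "past (n' * L + m) (?A zs)" for zs
    proof (rule past_Collect)
      fix \<omega> \<omega>' assume eq: "\<And>i. i \<le> n' * L + m \<Longrightarrow> X i \<omega> = X i \<omega>'"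
        and *: "\<forall>i<n. ?Z i \<omega> = zs i"
      have iL: "i * L \<le> n' * L" if "i < n" for i
        using that Suc by (intro mult_le_mono1) simp
      show "\<forall>i<n. ?Z i \<omega>' = zs i"
      proof (intro allI impI)
        fix i assume "i < n"
        then have "X (i * L) \<omega> = X (i * L) \<omega>'" "X (i * L + m) \<omega> = X (i * L + m) \<omega>'"
          using iL[of i] by (intro eq; linarith)+
        then show "?Z i \<omega>' = zs i" using *[rule_format, OF \<open>i < n\<close>] by (simp only:)
      qed
    qed
    have "(\<Sum>zs\<in>PiE {..<n} (\<lambda>_. S \<times> S). \<Sum>u\<in>S.
        \<bar>prob {\<omega> \<in> ?A zs. X ((n' * L + m) + (L - m)) \<omega> = u} - prob (?A zs) * \<pi> u\<bar>) \<le> 2 * \<beta> (L - m)"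
    proof (rule mixing_past_events[where A = ?A])
      show "finite (PiE {..<n} (\<lambda>_. S \<times> S))" using finite_S by (intro finite_PiE) auto
    qed (rule disjoint_PiE_paths, rule past)
    moreover have nL: "(n' * L + m) + (L - m) = n * L" using Suc \<open>m \<le> L\<close> by simp
    moreover have "past (n * L) (?A zs)" for zs
      using past_mono[OF past[of zs], of "n * L"] nL by linarith
    ultimately show ?thesis by simp
  qed
  have "(\<Sum>zs\<in>PiE {..<n} (\<lambda>_. S \<times> S). \<Sum>z\<in>S \<times> S.
        \<bar>prob {\<omega> \<in> space M. (\<forall>i<n. ?Z i \<omega> = zs i) \<and> ?Z n \<omega> = z} - prob (?A zs) * pmf q z\<bar>)
      \<le> (\<Sum>zs\<in>PiE {..<n} (\<lambda>_. S \<times> S). \<Sum>u\<in>S. \<bar>prob {\<omega> \<in> ?A zs. X (n * L) \<omega> = u} - prob (?A zs) * \<pi> u\<bar>)"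
  proof (rule sum_mono)
    fix zs
    note past = conjunct2[OF *, rule_format, of zs]
    have eq: "prob {\<omega> \<in> space M. (\<forall>i<n. ?Z i \<omega> = zs i) \<and> ?Z n \<omega> = (u, v)} - prob (?A zs) * pmf q (u, v)
        = (prob {\<omega> \<in> ?A zs. X (n * L) \<omega> = u} - prob (?A zs) * \<pi> u) * K m u v"
      if "u \<in> S" "v \<in> S" for u v
    proof -
      have "{\<omega> \<in> space M. (\<forall>i<n. ?Z i \<omega> = zs i) \<and> ?Z n \<omega> = (u, v)}
          = {\<omega> \<in> ?A zs. X (n * L) \<omega> = u \<and> X (n * L + m) \<omega> = v}" by auto
      moreover have "pmf q (u, v) = \<pi> u * K m u v" using q(2) that by (simp add: \<pi>_K)
      ultimately show ?thesis using multi_step[OF past, of u m v] by (simp add: algebra_simps)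
    qed
    have "(\<Sum>z\<in>S \<times> S.
        \<bar>prob {\<omega> \<in> space M. (\<forall>i<n. ?Z i \<omega> = zs i) \<and> ?Z n \<omega> = z} - prob (?A zs) * pmf q z\<bar>)
        = (\<Sum>u\<in>S. \<Sum>v\<in>S. \<bar>prob {\<omega> \<in> ?A zs. X (n * L) \<omega> = u} - prob (?A zs) * \<pi> u\<bar> * K m u v)"
      unfolding sum.cartesian_product'
      by (intro sum.cong refl, subst eq) (auto simp: abs_mult)
    also have "\<dots> = (\<Sum>u\<in>S. \<bar>prob {\<omega> \<in> ?A zs. X (n * L) \<omega> = u} - prob (?A zs) * \<pi> u\<bar> * (\<Sum>v\<in>S. K m u v))"
      by (simp add: sum_distrib_left)
    also have "\<dots> \<le> (\<Sum>u\<in>S. \<bar>prob {\<omega> \<in> ?A zs. X (n * L) \<omega> = u} - prob (?A zs) * \<pi> u\<bar> * 1)"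
      by (intro sum_mono mult_left_mono sum_K_le_1) auto
    finally show "(\<Sum>z\<in>S \<times> S.
        \<bar>prob {\<omega> \<in> space M. (\<forall>i<n. ?Z i \<omega> = zs i) \<and> ?Z n \<omega> = z} - prob (?A zs) * pmf q z\<bar>)
        \<le> (\<Sum>u\<in>S. \<bar>prob {\<omega> \<in> ?A zs. X (n * L) \<omega> = u} - prob (?A zs) * \<pi> u\<bar>)" by simp
  qed
  also have "\<dots> \<le> 2 * \<beta> (L - m)" using * by blast
  finally show "(\<Sum>zs\<in>PiE {..<n} (\<lambda>_. S \<times> S). \<Sum>z\<in>S \<times> S.
        \<bar>prob {\<omega> \<in> space M. (\<forall>i<n. ?Z i \<omega> = zs i) \<and> ?Z n \<omega> = z} - prob (?A zs) * pmf q z\<bar>)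
      \<le> 2 * \<beta> (L - m)" .
qed (use assms(1,3) finite_S X_in in simp_all)

end

section \<open>Deviation of the estimator\<close>

lemma sum_lessThan_double:
  fixes f :: "nat \<Rightarrow> 'b::comm_monoid_add"
  shows "(\<Sum>i<2 * n. f i) = (\<Sum>i<n. f (2 * i)) + (\<Sum>i<n. f (2 * i + 1))"
  by (induction n) (simp_all add: ac_simps)

context prob_space
begin

lemma measurable_emp_freq:
  assumes "\<And>i. {\<omega> \<in> space M. Y i \<omega> = z} \<in> events"
  shows "(\<lambda>\<omega>. emp_freq N (\<lambda>i. Y i \<omega>) z) \<in> borel_measurable M"
proof -
  have "(\<lambda>\<omega>. indicator {z} (Y i \<omega>) :: real) \<in> borel_measurable M" for i
  proof -
    have "(\<lambda>\<omega>. indicator {\<omega> \<in> space M. Y i \<omega> = z} \<omega> :: real) \<in> borel_measurable M"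
      using assms by (intro borel_measurable_indicator)
    moreover have "(\<lambda>\<omega>. indicator {z} (Y i \<omega>) :: real) \<in> borel_measurable M
        \<longleftrightarrow> (\<lambda>\<omega>. indicator {\<omega> \<in> space M. Y i \<omega> = z} \<omega> :: real) \<in> borel_measurable M"
      by (rule measurable_cong) (simp add: indicator_def)
    ultimately show ?thesis by simp
  qed
  then show ?thesis unfolding emp_freq_def by measurable
qed

text \<open>
  This bound needs identical distribution only and no independence.  It is small when the law is
  almost a point mass.
\<close>

lemma mean_abs_deviation_identical:
  assumes Y: "\<And>i. {\<omega> \<in> space M. Y i \<omega> = z} \<in> events"
    and p: "\<And>i. prob {\<omega> \<in> space M. Y i \<omega> = z} = p" and N: "0 < N"
  shows "expectation (\<lambda>\<omega>. \<bar>emp_freq N (\<lambda>i. Y i \<omega>) z - p\<bar>) \<le> 2 * p * (1 - p)"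
proof -
  let ?I = "\<lambda>i. indicator {\<omega> \<in> space M. Y i \<omega> = z} :: 'a \<Rightarrow> real"
  have p01: "0 \<le> p" "p \<le> 1" using p[of 0] by auto
  have int: "integrable M (?I i)" for i
    using Y by (intro integrable_real_indicator) (auto simp: emeasure_eq_measure)
  have int': "integrable M (\<lambda>\<omega>. (\<Sum>i<N. (1 - 2 * p) * ?I i \<omega> + p) / real N)"
    by (intro Bochner_Integration.integrable_divide Bochner_Integration.integrable_sum
        Bochner_Integration.integrable_add integrable_mult_right int integrable_const)
  have "expectation (\<lambda>\<omega>. \<bar>emp_freq N (\<lambda>i. Y i \<omega>) z - p\<bar>)
      \<le> expectation (\<lambda>\<omega>. (\<Sum>i<N. (1 - 2 * p) * ?I i \<omega> + p) / real N)"
  proof (rule integral_mono'[OF int'])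
    fix \<omega> assume \<omega>: "\<omega> \<in> space M"
    have "emp_freq N (\<lambda>i. Y i \<omega>) z - p = (\<Sum>i<N. ?I i \<omega> - p) / real N"
      using N \<omega> by (simp add: emp_freq_def sum_subtractf diff_divide_distrib indicator_def)
    also have "\<bar>\<dots>\<bar> \<le> (\<Sum>i<N. \<bar>?I i \<omega> - p\<bar>) / real N"
      using sum_abs[of "\<lambda>i. ?I i \<omega> - p" "{..<N}"] by (simp add: abs_divide divide_right_mono)
    also have "(\<Sum>i<N. \<bar>?I i \<omega> - p\<bar>) = (\<Sum>i<N. (1 - 2 * p) * ?I i \<omega> + p)"
      using p01 by (intro sum.cong) (auto simp: indicator_def)
    finally show "\<bar>emp_freq N (\<lambda>i. Y i \<omega>) z - p\<bar> \<le> (\<Sum>i<N. (1 - 2 * p) * ?I i \<omega> + p) / real N" .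
    show "0 \<le> (\<Sum>i<N. (1 - 2 * p) * ?I i \<omega> + p) / real N"
      using p01 by (intro divide_nonneg_nonneg sum_nonneg) (auto simp: indicator_def)
  qed
  also have "\<dots> = (\<Sum>i<N. (1 - 2 * p) * p + p) / real N"
  proof -
    have "expectation (\<lambda>\<omega>. (1 - 2 * p) * ?I i \<omega> + p) = (1 - 2 * p) * p + p" for i
    proof -
      have "expectation (?I i) = p" using p[of i] by (simp add: Int_absorb2)
      then show ?thesis using int[of i] by (simp add: prob_space)
    qed
    then show ?thesis
      by (simp add: Bochner_Integration.integral_sum int)
  qed
  also have "\<dots> = 2 * p * (1 - p)" using N by (simp add: field_simps)
  finally show ?thesis .
qed

end

lemma sum_abs_diff_product_le:
  fixes a p :: "'z \<Rightarrow> real"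
  assumes "\<And>u. u \<in> S \<Longrightarrow> 0 \<le> a u" "(\<Sum>u\<in>S. a u) = 1" "\<And>u. u \<in> S \<Longrightarrow> 0 \<le> p u" "(\<Sum>u\<in>S. p u) = 1"
  shows "(\<Sum>u\<in>S. \<Sum>v\<in>S. \<bar>a u * a v - p u * p v\<bar>) \<le> 2 * (\<Sum>u\<in>S. \<bar>a u - p u\<bar>)"
proof -
  have "(\<Sum>u\<in>S. \<Sum>v\<in>S. \<bar>a u * a v - p u * p v\<bar>)
      \<le> (\<Sum>u\<in>S. \<Sum>v\<in>S. a u * \<bar>a v - p v\<bar> + \<bar>a u - p u\<bar> * p v)"
  proof (intro sum_mono)
    fix u v assume "u \<in> S" "v \<in> S"
    have "a u * a v - p u * p v = a u * (a v - p v) + (a u - p u) * p v" by (simp add: algebra_simps)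
    then show "\<bar>a u * a v - p u * p v\<bar> \<le> a u * \<bar>a v - p v\<bar> + \<bar>a u - p u\<bar> * p v"
      using abs_triangle_ineq[of "a u * (a v - p v)" "(a u - p u) * p v"]
        assms(1)[OF \<open>u \<in> S\<close>] assms(3)[OF \<open>v \<in> S\<close>] by (simp add: abs_mult)
  qed
  also have "\<dots> = (\<Sum>u\<in>S. a u) * (\<Sum>v\<in>S. \<bar>a v - p v\<bar>) + (\<Sum>u\<in>S. \<bar>a u - p u\<bar>) * (\<Sum>v\<in>S. p v)"
    by (simp only: sum.distrib sum_product)
  finally show ?thesis by (simp add: assms)
qed

context stationary_markov_chain
begin

text \<open>
  The pairs \<open>(X\<^sub>2\<^sub>i\<^sub>(\<^sub>k\<^sub>+\<^sub>1\<^sub>), X\<^sub>2\<^sub>i\<^sub>(\<^sub>k\<^sub>+\<^sub>1\<^sub>)\<^sub>+\<^sub>m)\<close> that enter the empirical joint law.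
\<close>

abbreviation pairs :: "nat \<Rightarrow> nat \<Rightarrow> nat \<Rightarrow> 'a \<Rightarrow> real \<times> real" where
  "pairs k m i \<omega> \<equiv> (X (i * (2 * (k + 1))) \<omega>, X (i * (2 * (k + 1)) + m) \<omega>)"

text \<open>
  The \<open>\<ell>\<^sup>1\<close> deviations of the empirical frequencies from their expectations: for the pairs, and for the
  marginal subsample that starts at time \<open>s\<close> and proceeds in steps of \<open>2 k\<close>.
\<close>

definition dev_joint :: "nat \<Rightarrow> nat \<Rightarrow> nat \<Rightarrow> 'a \<Rightarrow> real" where
  "dev_joint k N m \<omega> = (\<Sum>z\<in>S \<times> S. \<bar>emp_freq N (\<lambda>i. pairs k m i \<omega>) z - (case z of (u, v) \<Rightarrow> J m u v)\<bar>)"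

definition dev_marginal :: "nat \<Rightarrow> nat \<Rightarrow> nat \<Rightarrow> 'a \<Rightarrow> real" where
  "dev_marginal s k N \<omega> = (\<Sum>u\<in>S. \<bar>emp_freq N (\<lambda>i. X (s + i * (2 * k)) \<omega>) u - \<pi> u\<bar>)"

lemma emp_joint_eq: "emp_joint X k N m \<omega> z = emp_freq N (\<lambda>i. pairs k m i \<omega>) z"
  by (simp add: emp_joint_def emp_freq_def mult.assoc mult.left_commute[of 2])

lemma emp_marginal_eq:
  "emp_marginal X k N \<omega> u
    = (emp_freq N (\<lambda>i. X (0 + i * (2 * k)) \<omega>) u + emp_freq N (\<lambda>i. X (k + i * (2 * k)) \<omega>) u) / 2"
proof -
  have "k * (2 * i) = 0 + i * (2 * k)" "k * (2 * i + 1) = k + i * (2 * k)" for i by (simp_all add: algebra_simps)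
  then show ?thesis
    by (simp only: emp_marginal_def emp_freq_def sum_lessThan_double) (simp add: add_divide_distrib)
qed

lemma events_pairs: "{\<omega> \<in> space M. pairs k m i \<omega> = z} \<in> events"
  by (cases z) simp

lemma events_X: "{\<omega> \<in> space M. X t \<omega> = u} \<in> events"
  by simp

lemma prob_pairs: "prob {\<omega> \<in> space M. pairs k m i \<omega> = z} = (case z of (u, v) \<Rightarrow> J m u v)"
  by (cases z) (simp add: prob_pair_shift)

lemma measurable_dev_joint [measurable]: "dev_joint k N m \<in> borel_measurable M"
  unfolding dev_joint_def
  by (intro borel_measurable_sum borel_measurable_abs borel_measurable_diff measurable_emp_freq
      events_pairs borel_measurable_const)

lemma measurable_dev_marginal [measurable]: "dev_marginal s k N \<in> borel_measurable M"
  unfolding dev_marginal_def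
  by (intro borel_measurable_sum borel_measurable_abs borel_measurable_diff measurable_emp_freq
      events_X borel_measurable_const)

lemma sum_J_pairs: "(\<Sum>z\<in>S \<times> S. case z of (u, v) \<Rightarrow> J m u v) = 1"
  by (simp add: sum_J sum_\<pi> flip: sum.cartesian_product)

lemma emp_marginal_nonneg: "0 \<le> emp_marginal X k N \<omega> u"
  unfolding emp_marginal_eq by (intro divide_nonneg_nonneg add_nonneg_nonneg emp_freq_nonneg) simp

lemma sum_emp_marginal:
  assumes "\<omega> \<in> space M" "0 < N"
  shows "(\<Sum>u\<in>S. emp_marginal X k N \<omega> u) = 1"
  using assms X_in[OF assms(1)] finite_S
  by (simp add: emp_marginal_eq sum.distrib sum_emp_freq flip: sum_divide_distrib)

lemma deviation_le:
  assumes \<omega>: "\<omega> \<in> space M" and N: "0 < N"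
  shows "\<bar>beta_hat X S k N m \<omega> - \<beta> m\<bar>
    \<le> (dev_joint k N m \<omega> + dev_marginal 0 k N \<omega> + dev_marginal k k N \<omega>) / 2"
proof -
  let ?a = "emp_marginal X k N \<omega>"
  let ?P = "\<lambda>u v. emp_joint X k N m \<omega> (u, v)"
  have "\<bar>beta_hat X S k N m \<omega> - \<beta> m\<bar>
      = \<bar>\<Sum>u\<in>S. \<Sum>v\<in>S. \<bar>?P u v - ?a u * ?a v\<bar> - \<bar>J m u v - \<pi> u * \<pi> v\<bar>\<bar> / 2"
    by (simp add: beta_hat_def beta_eq sum_subtractf abs_divide flip: diff_divide_distrib)
  also have "\<dots> \<le> (\<Sum>u\<in>S. \<Sum>v\<in>S. \<bar>\<bar>?P u v - ?a u * ?a v\<bar> - \<bar>J m u v - \<pi> u * \<pi> v\<bar>\<bar>) / 2"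
    by (intro divide_right_mono order_trans[OF sum_abs] sum_mono sum_abs) auto
  also have "\<dots> \<le> (\<Sum>u\<in>S. \<Sum>v\<in>S. \<bar>?P u v - J m u v\<bar> + \<bar>?a u * ?a v - \<pi> u * \<pi> v\<bar>) / 2"
    by (intro divide_right_mono sum_mono) linarith+
  also have "\<dots> = ((\<Sum>u\<in>S. \<Sum>v\<in>S. \<bar>?P u v - J m u v\<bar>) + (\<Sum>u\<in>S. \<Sum>v\<in>S. \<bar>?a u * ?a v - \<pi> u * \<pi> v\<bar>)) / 2"
    by (simp only: sum.distrib)
  also have "(\<Sum>u\<in>S. \<Sum>v\<in>S. \<bar>?P u v - J m u v\<bar>) = dev_joint k N m \<omega>"
    by (simp add: dev_joint_def emp_joint_eq sum.cartesian_product case_prod_unfold)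
  also have "(\<Sum>u\<in>S. \<Sum>v\<in>S. \<bar>?a u * ?a v - \<pi> u * \<pi> v\<bar>) \<le> 2 * (\<Sum>u\<in>S. \<bar>?a u - \<pi> u\<bar>)"
    using emp_marginal_nonneg sum_emp_marginal[OF \<omega> N] sum_\<pi> by (intro sum_abs_diff_product_le) auto
  also have "2 * (\<Sum>u\<in>S. \<bar>?a u - \<pi> u\<bar>) \<le> dev_marginal 0 k N \<omega> + dev_marginal k k N \<omega>"
  proof -
    have "2 * \<bar>(x + y) / 2 - c\<bar> \<le> \<bar>x - c\<bar> + \<bar>y - c\<bar>" for x y c :: real
      by argo
    then show ?thesis
      unfolding dev_marginal_def sum.distrib[symmetric] sum_distrib_left emp_marginal_eq
      by (intro sum_mono)
  qed
  finally show ?thesis by (simp add: add.assoc)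
qed

lemma beta_hat_measurable [measurable]: "beta_hat X S k N m \<in> borel_measurable M"
proof -
  have "(\<lambda>\<omega>. emp_joint X k N m \<omega> z) \<in> borel_measurable M" for z
    unfolding emp_joint_eq by (intro measurable_emp_freq events_pairs)
  moreover have "(\<lambda>\<omega>. emp_marginal X k N \<omega> u) \<in> borel_measurable M" for u
    unfolding emp_marginal_eq
    by (intro borel_measurable_divide borel_measurable_add measurable_emp_freq events_X
        borel_measurable_const)
  ultimately show ?thesis unfolding beta_hat_def[abs_def] by measurable
qed

lemma total_variation_le_1:
  fixes P :: "real \<Rightarrow> real \<Rightarrow> real"
  assumes "\<And>u v. 0 \<le> P u v" "(\<Sum>u\<in>S. \<Sum>v\<in>S. P u v) = 1" "\<And>u. 0 \<le> a u" "(\<Sum>u\<in>S. a u) = 1"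
  shows "1 / 2 * (\<Sum>u\<in>S. \<Sum>v\<in>S. \<bar>P u v - a u * a v\<bar>) \<in> {0..1}"
proof -
  have "(\<Sum>u\<in>S. \<Sum>v\<in>S. \<bar>P u v - a u * a v\<bar>) \<le> (\<Sum>u\<in>S. \<Sum>v\<in>S. P u v + a u * a v)"
  proof (intro sum_mono)
    fix u v
    have "0 \<le> a u * a v" using assms(3) by simp
    then show "\<bar>P u v - a u * a v\<bar> \<le> P u v + a u * a v" using assms(1)[of u v] by linarith
  qed
  also have "\<dots> = 1 + (\<Sum>u\<in>S. a u) * (\<Sum>v\<in>S. a v)"
    by (simp only: sum.distrib assms(2) sum_product)
  finally show ?thesis by (simp add: assms(4) sum_nonneg)
qed

lemma deviation_le_1:
  assumes \<omega>: "\<omega> \<in> space M" and N: "0 < N"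
  shows "\<bar>beta_hat X S k N m \<omega> - \<beta> m\<bar> \<le> 1"
proof -
  have "beta_hat X S k N m \<omega> \<in> {0..1}"
    unfolding beta_hat_def
  proof (rule total_variation_le_1)
    have "(\<Sum>z\<in>S \<times> S. emp_joint X k N m \<omega> z) = 1"
      unfolding emp_joint_eq using finite_S X_in[OF \<omega>] N by (intro sum_emp_freq) auto
    then show "(\<Sum>u\<in>S. \<Sum>v\<in>S. emp_joint X k N m \<omega> (u, v)) = 1"
      by (simp add: sum.cartesian_product)
  qed (auto simp: emp_joint_eq emp_freq_nonneg emp_marginal_nonneg sum_emp_marginal \<omega> N)
  moreover have "\<beta> m \<in> {0..1}"
    unfolding beta_eq by (rule total_variation_le_1) (simp_all add: sum_\<pi> sum_J)
  ultimately show ?thesis by auto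
qed

lemma integrable_deviation: "0 < N \<Longrightarrow> integrable M (\<lambda>\<omega>. \<bar>beta_hat X S k N m \<omega> - \<beta> m\<bar>)"
  by (rule integrable_const_bound[where B = 1]) (auto simp: deviation_le_1)

lemma dev_joint_bounds:
  assumes "\<omega> \<in> space M" "0 < N"
  shows "0 \<le> dev_joint k N m \<omega>" "dev_joint k N m \<omega> \<le> 2"
proof -
  show "dev_joint k N m \<omega> \<le> 2" unfolding dev_joint_def
    using assms finite_S X_in sum_J_pairs by (intro sum_abs_diff_emp_freq_le_2) auto
qed (simp add: dev_joint_def sum_nonneg)

lemma dev_marginal_bounds:
  assumes "\<omega> \<in> space M" "0 < N"
  shows "0 \<le> dev_marginal s k N \<omega>" "dev_marginal s k N \<omega> \<le> 2"
proof -
  show "dev_marginal s k N \<omega> \<le> 2" unfolding dev_marginal_def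
    using assms finite_S X_in sum_\<pi> by (intro sum_abs_diff_emp_freq_le_2) auto
qed (simp add: dev_marginal_def sum_nonneg)

lemma integrable_dev:
  assumes "0 < N"
  shows "integrable M (dev_joint k N m)" "integrable M (dev_marginal s k N)"
  using assms by (auto intro!: integrable_const_bound[where B = 2] simp: dev_joint_bounds dev_marginal_bounds)

lemma expectation_deviation_le:
  assumes N: "0 < N"
  shows "expectation (\<lambda>\<omega>. \<bar>beta_hat X S k N m \<omega> - \<beta> m\<bar>)
    \<le> (expectation (dev_joint k N m) + expectation (dev_marginal 0 k N) + expectation (dev_marginal k k N)) / 2"
proof -
  have "expectation (\<lambda>\<omega>. \<bar>beta_hat X S k N m \<omega> - \<beta> m\<bar>)
      \<le> expectation (\<lambda>\<omega>. (dev_joint k N m \<omega> + dev_marginal 0 k N \<omega> + dev_marginal k k N \<omega>) / 2)"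
    using integrable_dev[OF N] integrable_deviation[OF N] deviation_le N by (intro integral_mono) auto
  then show ?thesis using integrable_dev[OF N] by simp
qed

lemma beta_0: "\<beta> 0 = (\<Sum>u\<in>S. \<pi> u * (1 - \<pi> u))"
proof -
  have \<pi>1: "\<pi> u \<le> 1" for u by (simp add: \<pi>_def)
  have "J 0 u v = (if u = v then \<pi> u else 0)" for u v
  proof -
    have "u \<noteq> v \<Longrightarrow> {\<omega> \<in> space M. X 0 \<omega> = u \<and> X 0 \<omega> = v} = {}" by auto
    then show ?thesis by (auto simp: J_def \<pi>_def simp del: Collect_empty_eq)
  qed
  then have "\<bar>J 0 u v - \<pi> u * \<pi> v\<bar> = \<pi> u * \<pi> v + (if u = v then \<pi> u - 2 * \<pi> u * \<pi> u else 0)" for u v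
    using mult_left_mono[OF \<pi>1[of u] \<pi>_nonneg[of u]] by (cases "u = v") (simp_all add: abs_mult)
  then have "\<beta> 0 = 1 / 2 * (\<Sum>u\<in>S. \<pi> u + (\<pi> u - 2 * \<pi> u * \<pi> u))"
    using finite_S by (simp add: beta_eq sum.distrib sum_\<pi> flip: sum_distrib_left)
  also have "\<dots> = (\<Sum>u\<in>S. \<pi> u * (1 - \<pi> u))"
    unfolding sum_distrib_left by (intro sum.cong) (auto simp: algebra_simps)
  finally show ?thesis .
qed

lemma expectation_dev_marginal_le_beta_0:
  assumes N: "0 < N"
  shows "expectation (dev_marginal s k N) \<le> 2 * \<beta> 0"
proof -
  have "expectation (dev_marginal s k N)
      = (\<Sum>u\<in>S. expectation (\<lambda>\<omega>. \<bar>emp_freq N (\<lambda>i. X (s + i * (2 * k)) \<omega>) u - \<pi> u\<bar>))"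
  proof -
    have "integrable M (\<lambda>\<omega>. \<bar>emp_freq N (\<lambda>i. X (s + i * (2 * k)) \<omega>) u - \<pi> u\<bar>)" if "u \<in> S" for u
    proof (rule integrable_const_bound[where B = 2])
      show "AE \<omega> in M. norm \<bar>emp_freq N (\<lambda>i. X (s + i * (2 * k)) \<omega>) u - \<pi> u\<bar> \<le> 2"
      proof (rule AE_I2)
        fix \<omega> assume "\<omega> \<in> space M"
        have "\<bar>emp_freq N (\<lambda>i. X (s + i * (2 * k)) \<omega>) u - \<pi> u\<bar> \<le> dev_marginal s k N \<omega>"
          unfolding dev_marginal_def using that finite_S
          by (intro member_le_sum[of u S "\<lambda>u. \<bar>emp_freq N (\<lambda>i. X (s + i * (2 * k)) \<omega>) u - \<pi> u\<bar>"]) auto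
        then show "norm \<bar>emp_freq N (\<lambda>i. X (s + i * (2 * k)) \<omega>) u - \<pi> u\<bar> \<le> 2"
          using dev_marginal_bounds(2)[OF \<open>\<omega> \<in> space M\<close> N, of s k] by simp
      qed
    qed (intro borel_measurable_abs borel_measurable_diff measurable_emp_freq events_X borel_measurable_const)
    then show ?thesis unfolding dev_marginal_def by (rule Bochner_Integration.integral_sum)
  qed
  also have "\<dots> \<le> (\<Sum>u\<in>S. 2 * \<pi> u * (1 - \<pi> u))"
    by (intro sum_mono mean_abs_deviation_identical events_X prob_shift N)
  finally show ?thesis by (simp add: beta_0 sum_distrib_left mult.assoc)
qed

text \<open>
  The bound rests on \<open>1 - J m u v \<le> (1 - \<pi> u) + (1 - \<pi> v)\<close> and on \<open>beta_0\<close>.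
\<close>

lemma expectation_dev_joint_le_beta_0:
  assumes N: "0 < N"
  shows "expectation (dev_joint k N m) \<le> 4 * \<beta> 0"
proof -
  let ?d = "\<lambda>z \<omega>. \<bar>emp_freq N (\<lambda>i. pairs k m i \<omega>) z - (case z of (u, v) \<Rightarrow> J m u v)\<bar>"
  have "expectation (dev_joint k N m) = (\<Sum>z\<in>S \<times> S. expectation (?d z))"
  proof -
    have "integrable M (?d z)" if "z \<in> S \<times> S" for z
    proof (rule integrable_const_bound[where B = 2])
      show "AE \<omega> in M. norm (?d z \<omega>) \<le> 2"
      proof (rule AE_I2)
        fix \<omega> assume "\<omega> \<in> space M"
        have "?d z \<omega> \<le> dev_joint k N m \<omega>"
          unfolding dev_joint_def using that finite_S by (intro member_le_sum[of z _ "\<lambda>z. ?d z \<omega>"]) auto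
        then show "norm (?d z \<omega>) \<le> 2"
          using dev_joint_bounds(2)[OF \<open>\<omega> \<in> space M\<close> N, of k m] by simp
      qed
    qed (intro borel_measurable_abs borel_measurable_diff measurable_emp_freq events_pairs borel_measurable_const)
    then show ?thesis unfolding dev_joint_def by (rule Bochner_Integration.integral_sum)
  qed
  also have "\<dots> \<le> (\<Sum>z\<in>S \<times> S. 2 * (case z of (u, v) \<Rightarrow> J m u v) * (1 - (case z of (u, v) \<Rightarrow> J m u v)))"
    by (intro sum_mono mean_abs_deviation_identical events_pairs prob_pairs N)
  also have "\<dots> = (\<Sum>u\<in>S. \<Sum>v\<in>S. 2 * J m u v * (1 - J m u v))"
    by (simp add: sum.cartesian_product case_prod_unfold)
  also have "\<dots> \<le> (\<Sum>u\<in>S. \<Sum>v\<in>S. 2 * J m u v * ((1 - \<pi> u) + (1 - \<pi> v)))"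
  proof (intro sum_mono mult_left_mono)
    fix u v
    have "1 - J m u v = prob (space M - {\<omega> \<in> space M. X 0 \<omega> = u \<and> X m \<omega> = v})"
      unfolding J_def by (subst prob_compl) auto
    also have "\<dots> \<le> prob ((space M - {\<omega> \<in> space M. X 0 \<omega> = u}) \<union> (space M - {\<omega> \<in> space M. X m \<omega> = v}))"
      by (intro finite_measure_mono) auto
    also have "\<dots> \<le> prob (space M - {\<omega> \<in> space M. X 0 \<omega> = u}) + prob (space M - {\<omega> \<in> space M. X m \<omega> = v})"
      by (intro measure_Un_le) auto
    also have "\<dots> = (1 - \<pi> u) + (1 - \<pi> v)"
      by (simp add: prob_compl prob_shift)
    finally show "1 - J m u v \<le> (1 - \<pi> u) + (1 - \<pi> v)" .
  qed auto
  also have "\<dots> = 2 * (\<Sum>u\<in>S. \<Sum>v\<in>S. J m u v * (1 - \<pi> u)) + 2 * (\<Sum>u\<in>S. \<Sum>v\<in>S. J m u v * (1 - \<pi> v))"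
    unfolding sum_distrib_left sum.distrib[symmetric]
    by (intro sum.cong refl) (simp add: algebra_simps)
  also have "(\<Sum>u\<in>S. \<Sum>v\<in>S. J m u v * (1 - \<pi> u)) = \<beta> 0"
    by (simp add: beta_0 sum_J flip: sum_distrib_right)
  also have "(\<Sum>u\<in>S. \<Sum>v\<in>S. J m u v * (1 - \<pi> v)) = \<beta> 0"
  proof -
    have "(\<Sum>u\<in>S. J m u v) = \<pi> v" for v
    proof -
      have "(\<Sum>u\<in>S. prob {\<omega> \<in> {\<omega> \<in> space M. X m \<omega> = v}. X 0 \<omega> = u}) = \<pi> v"
        using prob_sum_values[OF events_X, of m v 0] by (simp add: prob_shift)
      moreover have "{\<omega> \<in> {\<omega> \<in> space M. X m \<omega> = v}. X 0 \<omega> = u}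
          = {\<omega> \<in> space M. X 0 \<omega> = u \<and> X m \<omega> = v}" for u by auto
      ultimately show ?thesis by (simp only: J_def)
    qed
    then show ?thesis
      by (subst sum.swap) (simp add: beta_0 flip: sum_distrib_right)
  qed
  finally show ?thesis by simp
qed

lemma expectation_deviation_le_beta_0:
  assumes N: "0 < N"
  shows "expectation (\<lambda>\<omega>. \<bar>beta_hat X S k N m \<omega> - \<beta> m\<bar>) \<le> 4 * \<beta> 0"
  using expectation_deviation_le[OF N, of k m] expectation_dev_joint_le_beta_0[OF N, of k m]
    expectation_dev_marginal_le_beta_0[OF N, of 0 k] expectation_dev_marginal_le_beta_0[OF N, of k k]
  by argo

lemma tail_le_beta_0:
  assumes N: "0 < N" and \<epsilon>: "0 < \<epsilon>"
  shows "prob {\<omega> \<in> space M. \<epsilon> \<le> \<bar>beta_hat X S k N m \<omega> - \<beta> m\<bar>} \<le> 4 * \<beta> 0 / \<epsilon>"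
proof -
  have "prob {\<omega> \<in> space M. \<epsilon> \<le> \<bar>beta_hat X S k N m \<omega> - \<beta> m\<bar>}
      \<le> expectation (\<lambda>\<omega>. \<bar>beta_hat X S k N m \<omega> - \<beta> m\<bar>) / \<epsilon>"
    using integrable_deviation[OF N] \<epsilon> by (intro integral_Markov_inequality_measure[where A = "{}"]) auto
  also have "\<dots> \<le> 4 * \<beta> 0 / \<epsilon>"
    using expectation_deviation_le_beta_0[OF N] \<epsilon> by (intro divide_right_mono) auto
  finally show ?thesis .
qed

lemma marginal_pmf:
  obtains q where "set_pmf q \<subseteq> S" "\<And>u. u \<in> S \<Longrightarrow> pmf q u = \<pi> u"
  by (rule finite_pmf_exists[OF finite_S, of \<pi>]) (auto simp: sum_\<pi>)

lemma joint_pmf: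
  obtains q where "set_pmf q \<subseteq> S \<times> S" "\<And>u v. u \<in> S \<Longrightarrow> v \<in> S \<Longrightarrow> pmf q (u, v) = J m u v"
proof -
  obtain q where q: "set_pmf q \<subseteq> S \<times> S" "\<And>z. z \<in> S \<times> S \<Longrightarrow> pmf q z = (case z of (u, v) \<Rightarrow> J m u v)"
    by (rule finite_pmf_exists[of "S \<times> S" "\<lambda>z. case z of (u, v) \<Rightarrow> J m u v"])
      (auto simp: finite_S sum_J_pairs)
  show ?thesis by (rule that[OF q(1)]) (simp add: q(2))
qed

lemma dev_joint_estimates:
  assumes N: "0 < N" and m: "m \<le> 2 * (k + 1)"
  shows "expectation (dev_joint k N m) \<le> real (card S) / sqrt N + 2 * real N * \<beta> (2 * (k + 1) - m)"
    and "0 \<le> t \<Longrightarrow> prob {\<omega> \<in> space M. real (card S) ^ 2 * t \<le> dev_joint k N m \<omega>}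
      \<le> real N * \<beta> (2 * (k + 1) - m) + 2 * real (card S) ^ 2 * exp (- 2 * real N * t\<^sup>2)"
proof -
  obtain q where q: "set_pmf q \<subseteq> S \<times> S" "\<And>u v. u \<in> S \<Longrightarrow> v \<in> S \<Longrightarrow> pmf q (u, v) = J m u v"
    using joint_pmf by blast
  interpret Z: nearly_iid M "pairs k m" "S \<times> S" q N "\<beta> (2 * (k + 1) - m)"
    by (rule nearly_iid_pair[OF q N m])
  have pmf_q: "pmf q z = (case z of (u, v) \<Rightarrow> J m u v)" if "z \<in> S \<times> S" for z
    using that q(2) by auto
  have dev: "dev_joint k N m \<omega> = (\<Sum>z\<in>S \<times> S. \<bar>emp_freq N (\<lambda>i. pairs k m i \<omega>) z - pmf q z\<bar>)" for \<omega>
    unfolding dev_joint_def by (intro sum.cong refl) (simp only: pmf_q)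
  show "expectation (dev_joint k N m) \<le> real (card S) / sqrt N + 2 * real N * \<beta> (2 * (k + 1) - m)"
    using Z.mean_total_deviation
    by (simp add: dev[abs_def] card_cartesian_product real_sqrt_divide real_sqrt_mult)
  assume t: "0 \<le> t"
  have "prob {\<omega> \<in> space M. real (card S) ^ 2 * t \<le> dev_joint k N m \<omega>}
      \<le> prob {\<omega> \<in> space M. \<exists>z\<in>S \<times> S. t \<le> \<bar>emp_freq N (\<lambda>i. pairs k m i \<omega>) z - pmf q z\<bar>}"
  proof (rule finite_measure_mono)
    show "{\<omega> \<in> space M. real (card S) ^ 2 * t \<le> dev_joint k N m \<omega>}
        \<subseteq> {\<omega> \<in> space M. \<exists>z\<in>S \<times> S. t \<le> \<bar>emp_freq N (\<lambda>i. pairs k m i \<omega>) z - pmf q z\<bar>}"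
    proof (safe, rule ccontr)
      fix \<omega> assume \<omega>: "\<omega> \<in> space M" and le: "real (card S) ^ 2 * t \<le> dev_joint k N m \<omega>"
        and "\<not> (\<exists>z\<in>S \<times> S. t \<le> \<bar>emp_freq N (\<lambda>i. pairs k m i \<omega>) z - pmf q z\<bar>)"
      then have "dev_joint k N m \<omega> < (\<Sum>z\<in>S \<times> S. t)"
        unfolding dev using finite_S X_in[OF \<omega>] by (intro sum_strict_mono) (auto simp: not_le)
      then show False using le by (simp add: card_cartesian_product power2_eq_square)
    qed
    have "(\<lambda>\<omega>. \<bar>emp_freq N (\<lambda>i. pairs k m i \<omega>) z - pmf q z\<bar>) \<in> borel_measurable M" for z
      by (intro borel_measurable_abs borel_measurable_diff measurable_emp_freq events_pairs
          borel_measurable_const)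
    then show "{\<omega> \<in> space M. \<exists>z\<in>S \<times> S. t \<le> \<bar>emp_freq N (\<lambda>i. pairs k m i \<omega>) z - pmf q z\<bar>} \<in> events"
      by (intro sets.sets_Collect_finite_Ex borel_measurable_le borel_measurable_const
          finite_cartesian_product finite_S)
  qed
  also have "\<dots> \<le> real N * \<beta> (2 * (k + 1) - m) + 2 * real (card S) ^ 2 * exp (- 2 * real N * t\<^sup>2)"
    using Z.tail_max_deviation[OF t] by (simp add: card_cartesian_product power2_eq_square)
  finally show "prob {\<omega> \<in> space M. real (card S) ^ 2 * t \<le> dev_joint k N m \<omega>}
      \<le> real N * \<beta> (2 * (k + 1) - m) + 2 * real (card S) ^ 2 * exp (- 2 * real N * t\<^sup>2)" .
qed

lemma dev_marginal_estimates:
  assumes N: "0 < N"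
  shows "expectation (dev_marginal s k N) \<le> sqrt (real (card S) / N) + 2 * real N * \<beta> (2 * k)"
    and "0 \<le> t \<Longrightarrow> prob {\<omega> \<in> space M. real (card S) * t \<le> dev_marginal s k N \<omega>}
      \<le> real N * \<beta> (2 * k) + 2 * real (card S) * exp (- 2 * real N * t\<^sup>2)"
proof -
  obtain q where q: "set_pmf q \<subseteq> S" "\<And>u. u \<in> S \<Longrightarrow> pmf q u = \<pi> u"
    using marginal_pmf by blast
  interpret Z: nearly_iid M "\<lambda>i. X (s + i * (2 * k))" S q N "\<beta> (2 * k)"
    by (rule nearly_iid_marginal[OF q N])
  have dev: "dev_marginal s k N \<omega> = (\<Sum>u\<in>S. \<bar>emp_freq N (\<lambda>i. X (s + i * (2 * k)) \<omega>) u - pmf q u\<bar>)" for \<omega>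
    unfolding dev_marginal_def by (intro sum.cong refl) (simp only: q)
  show "expectation (dev_marginal s k N) \<le> sqrt (real (card S) / N) + 2 * real N * \<beta> (2 * k)"
    using Z.mean_total_deviation by (simp only: dev[abs_def])
  assume t: "0 \<le> t"
  have "prob {\<omega> \<in> space M. real (card S) * t \<le> dev_marginal s k N \<omega>}
      \<le> prob {\<omega> \<in> space M. \<exists>u\<in>S. t \<le> \<bar>emp_freq N (\<lambda>i. X (s + i * (2 * k)) \<omega>) u - pmf q u\<bar>}"
  proof (rule finite_measure_mono)
    show "{\<omega> \<in> space M. real (card S) * t \<le> dev_marginal s k N \<omega>}
        \<subseteq> {\<omega> \<in> space M. \<exists>u\<in>S. t \<le> \<bar>emp_freq N (\<lambda>i. X (s + i * (2 * k)) \<omega>) u - pmf q u\<bar>}"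
    proof (safe, rule ccontr)
      fix \<omega> assume \<omega>: "\<omega> \<in> space M" and le: "real (card S) * t \<le> dev_marginal s k N \<omega>"
        and "\<not> (\<exists>u\<in>S. t \<le> \<bar>emp_freq N (\<lambda>i. X (s + i * (2 * k)) \<omega>) u - pmf q u\<bar>)"
      then have "dev_marginal s k N \<omega> < (\<Sum>u\<in>S. t)"
        unfolding dev using finite_S X_in[OF \<omega>] by (intro sum_strict_mono) (auto simp: not_le)
      then show False using le by simp
    qed
    have "(\<lambda>\<omega>. \<bar>emp_freq N (\<lambda>i. X (s + i * (2 * k)) \<omega>) u - pmf q u\<bar>) \<in> borel_measurable M" for u
      by (intro borel_measurable_abs borel_measurable_diff measurable_emp_freq events_X
          borel_measurable_const)
    then show "{\<omega> \<in> space M. \<exists>u\<in>S. t \<le> \<bar>emp_freq N (\<lambda>i. X (s + i * (2 * k)) \<omega>) u - pmf q u\<bar>} \<in> events"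
      by (intro sets.sets_Collect_finite_Ex borel_measurable_le borel_measurable_const
          finite_cartesian_product finite_S)
  qed
  also have "\<dots> \<le> real N * \<beta> (2 * k) + 2 * real (card S) * exp (- 2 * real N * t\<^sup>2)"
    by (rule Z.tail_max_deviation[OF t])
  finally show "prob {\<omega> \<in> space M. real (card S) * t \<le> dev_marginal s k N \<omega>}
      \<le> real N * \<beta> (2 * k) + 2 * real (card S) * exp (- 2 * real N * t\<^sup>2)" .
qed

lemma mean_deviation:
  assumes N: "0 < N" and m: "m \<le> 2 * (k + 1)"
  shows "expectation (\<lambda>\<omega>. \<bar>beta_hat X S k N m \<omega> - \<beta> m\<bar>)
    \<le> (real (card S) / 2 + sqrt (card S)) / sqrt N + real N * (\<beta> (2 * (k + 1) - m) + 2 * \<beta> (2 * k))"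
proof -
  have "expectation (\<lambda>\<omega>. \<bar>beta_hat X S k N m \<omega> - \<beta> m\<bar>)
      \<le> real (card S) / sqrt N / 2 + sqrt (card S / N) + real N * \<beta> (2 * (k + 1) - m) + 2 * real N * \<beta> (2 * k)"
    using expectation_deviation_le[OF N, of k m] dev_joint_estimates(1)[OF N m]
      dev_marginal_estimates(1)[OF N, of 0 k] dev_marginal_estimates(1)[OF N, of k k]
    by argo
  then show ?thesis by (simp add: real_sqrt_divide add_divide_distrib algebra_simps)
qed

lemma tail_deviation:
  assumes N: "0 < N" and m: "m \<le> 2 * (k + 1)" and S: "2 \<le> card S" and \<epsilon>: "0 < \<epsilon>"
  shows "prob {\<omega> \<in> space M. \<epsilon> \<le> \<bar>beta_hat X S k N m \<omega> - \<beta> m\<bar>}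
    \<le> real N * (\<beta> (2 * (k + 1) - m) + 2 * \<beta> (2 * k))
      + 4 * real (card S) ^ 2 * exp (- (2 * real N * \<epsilon>\<^sup>2 / real (card S) ^ 4))"
proof -
  define c where "c = real (card S)"
  have c: "2 \<le> c" using S by (simp add: c_def)
  define E where "E = exp (- (2 * real N * \<epsilon>\<^sup>2 / c ^ 4))"
  let ?A = "{\<omega> \<in> space M. \<epsilon> \<le> dev_joint k N m \<omega>}"
  let ?B = "\<lambda>s. {\<omega> \<in> space M. \<epsilon> / 2 \<le> dev_marginal s k N \<omega>}"
  have "prob {\<omega> \<in> space M. \<epsilon> \<le> \<bar>beta_hat X S k N m \<omega> - \<beta> m\<bar>} \<le> prob (?A \<union> (?B 0 \<union> ?B k))"
  proof (rule finite_measure_mono)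
    show "{\<omega> \<in> space M. \<epsilon> \<le> \<bar>beta_hat X S k N m \<omega> - \<beta> m\<bar>} \<subseteq> ?A \<union> (?B 0 \<union> ?B k)"
    proof
      fix \<omega> assume *: "\<omega> \<in> {\<omega> \<in> space M. \<epsilon> \<le> \<bar>beta_hat X S k N m \<omega> - \<beta> m\<bar>}"
      then have "\<epsilon> \<le> (dev_joint k N m \<omega> + dev_marginal 0 k N \<omega> + dev_marginal k k N \<omega>) / 2"
        using deviation_le[of \<omega> N k m] N by (auto intro: order_trans)
      then have "\<epsilon> \<le> dev_joint k N m \<omega> \<or> \<epsilon> / 2 \<le> dev_marginal 0 k N \<omega> \<or> \<epsilon> / 2 \<le> dev_marginal k k N \<omega>"
        by argo
      then show "\<omega> \<in> ?A \<union> (?B 0 \<union> ?B k)" using * by blast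
    qed
  qed measurable
  also have "\<dots> \<le> prob ?A + (prob (?B 0) + prob (?B k))"
    by (intro order_trans[OF measure_Un_le] add_mono order_refl) measurable
  also have "\<dots> \<le> (real N * \<beta> (2 * (k + 1) - m) + 2 * c\<^sup>2 * E)
      + ((real N * \<beta> (2 * k) + 2 * c * E) + (real N * \<beta> (2 * k) + 2 * c * E))"
  proof (intro add_mono)
    have "c ^ 4 = (c\<^sup>2)\<^sup>2" by simp
    then have e: "- 2 * real N * (\<epsilon> / c\<^sup>2)\<^sup>2 = - (2 * real N * \<epsilon>\<^sup>2 / c ^ 4)" by (simp add: power_divide)
    show "prob ?A \<le> real N * \<beta> (2 * (k + 1) - m) + 2 * c\<^sup>2 * E"
      using dev_joint_estimates(2)[OF N m, of "\<epsilon> / c\<^sup>2"] \<epsilon> c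
      unfolding c_def[symmetric] e E_def[symmetric] by simp
    have B: "prob (?B s) \<le> real N * \<beta> (2 * k) + 2 * c * E" for s
    proof -
      have "prob (?B s) \<le> real N * \<beta> (2 * k) + 2 * c * exp (- 2 * real N * (\<epsilon> / (2 * c))\<^sup>2)"
        using dev_marginal_estimates(2)[OF N, of "\<epsilon> / (2 * c)" s k] \<epsilon> c
        unfolding c_def[symmetric] by simp
      also have "exp (- 2 * real N * (\<epsilon> / (2 * c))\<^sup>2) \<le> E"
      proof -
        \<comment> \<open>with at least two states, the thresholds for the marginals exceed those for the pairs\<close>
        have "2 * c \<le> c\<^sup>2" using c by (simp add: power2_eq_square)
        then have "\<epsilon> / c\<^sup>2 \<le> \<epsilon> / (2 * c)" using c \<epsilon> by (intro divide_left_mono) auto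
        then have "(\<epsilon> / c\<^sup>2)\<^sup>2 \<le> (\<epsilon> / (2 * c))\<^sup>2" using \<epsilon> by (intro power_mono) auto
        then have "2 * real N * (\<epsilon> / c\<^sup>2)\<^sup>2 \<le> 2 * real N * (\<epsilon> / (2 * c))\<^sup>2" by (intro mult_left_mono) auto
        then show ?thesis unfolding E_def e[symmetric] by simp
      qed
      finally show ?thesis using c by (simp add: mult_left_mono)
    qed
    show "prob (?B 0) \<le> real N * \<beta> (2 * k) + 2 * c * E" "prob (?B k) \<le> real N * \<beta> (2 * k) + 2 * c * E"
      by (rule B)+
  qed
  also have "\<dots> \<le> real N * (\<beta> (2 * (k + 1) - m) + 2 * \<beta> (2 * k)) + 4 * c\<^sup>2 * E"
  proof -
    have "2 * c * E \<le> c\<^sup>2 * E"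
      using c by (intro mult_right_mono) (auto simp: power2_eq_square E_def)
    then show ?thesis by (simp add: algebra_simps)
  qed
  finally show ?thesis by (simp add: c_def E_def)
qed

end

section \<open>The choice of the lag\<close>

text \<open>
  The parameters of the theorem, with \<open>c\<close> in the role of the number of states.
\<close>

locale lag_choice =
  fixes c \<eta> \<gamma> :: real and n k N :: nat
  assumes c_pos: "0 < c" and \<eta>_pos: "0 < \<eta>" and \<gamma>_pos: "0 < \<gamma>"
    and k_def: "k = nat \<lfloor>1 / \<gamma> * ln (\<eta> * \<gamma> * real n powr (3 / 2) / (sqrt 2 * c))\<rfloor>"
    and N_def: "N = nat \<lfloor>(real n - real k) / (2 * (real k + 1))\<rfloor>"
    and N_ge_1: "1 \<le> N"
    and n_ge: "(sqrt 2 * c * exp (2 * \<gamma>) / (\<eta> * \<gamma>)) powr (2 / 3) \<le> real n"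
      "(\<eta> * \<gamma> / c) powr (2 / 3) \<le> real n"
begin

text \<open>
  The argument of the logarithm in the definition of \<open>k\<close>, and its logarithm.  By \<open>k_le\<close> and \<open>k_gt\<close>, \<open>k\<close>
  is the integer part of \<open>l / \<gamma>\<close>.
\<close>

definition A :: real where "A = \<eta> * \<gamma> * real n powr (3 / 2) / (sqrt 2 * c)"

definition l :: real where "l = ln A"

lemma N_bounds:
  "real N \<le> (real n - real k) / (2 * (real k + 1))" "(real n - real k) / (2 * (real k + 1)) < real N + 1"
proof -
  have "1 \<le> \<lfloor>(real n - real k) / (2 * (real k + 1))\<rfloor>" using N_ge_1 N_def by linarith
  then have "real N = of_int \<lfloor>(real n - real k) / (2 * (real k + 1))\<rfloor>" by (simp add: N_def)
  then show "real N \<le> (real n - real k) / (2 * (real k + 1))"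
    "(real n - real k) / (2 * (real k + 1)) < real N + 1" by linarith+
qed

lemma n_ge_3k: "3 * real k + 2 \<le> real n"
proof -
  have "1 \<le> (real n - real k) / (2 * (real k + 1))" using N_bounds(1) N_ge_1 by linarith
  then have "2 * (real k + 1) \<le> real n - real k" by (simp add: le_divide_eq)
  then show ?thesis by simp
qed

lemma n_pos: "0 < real n" using n_ge_3k by linarith

lemma powr_3_2_ge:
  assumes "0 < x" "x powr (2 / 3) \<le> real n"
  shows "x \<le> real n powr (3 / 2)"
proof -
  have "(x powr (2 / 3)) powr (3 / 2) \<le> real n powr (3 / 2)"
    using assms by (intro powr_mono2) auto
  then show ?thesis using assms(1) by (simp add: powr_powr)
qed

lemma A_pos: "0 < A" using c_pos \<eta>_pos \<gamma>_pos n_pos by (simp add: A_def)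

lemma l_ge: "2 * \<gamma> \<le> l"
proof -
  have "sqrt 2 * c * exp (2 * \<gamma>) / (\<eta> * \<gamma>) \<le> real n powr (3 / 2)"
    using c_pos \<eta>_pos \<gamma>_pos by (intro powr_3_2_ge n_ge) auto
  then have "exp (2 * \<gamma>) \<le> A" using c_pos \<eta>_pos \<gamma>_pos by (simp add: A_def field_simps)
  then show ?thesis unfolding l_def using A_pos by (simp add: ln_ge_iff)
qed

lemma l_pos: "0 < l" using l_ge \<gamma>_pos by linarith

lemma k_le: "real k * \<gamma> \<le> l" and k_gt: "l < (real k + 1) * \<gamma>" and k_ge_2: "2 \<le> real k"
proof -
  have "2 \<le> 1 / \<gamma> * l" using l_ge \<gamma>_pos by (simp add: field_simps)
  then have "2 \<le> \<lfloor>1 / \<gamma> * l\<rfloor>" by linarith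
  then have k: "real k = of_int \<lfloor>1 / \<gamma> * l\<rfloor>" by (simp add: k_def l_def A_def)
  then show "2 \<le> real k" using \<open>2 \<le> \<lfloor>1 / \<gamma> * l\<rfloor>\<close> by linarith
  have "real k \<le> 1 / \<gamma> * l" "1 / \<gamma> * l < real k + 1" unfolding k by linarith+
  then show "real k * \<gamma> \<le> l" "l < (real k + 1) * \<gamma>" using \<gamma>_pos by (simp_all add: field_simps)
qed

lemma l_le: "l \<le> 3 * ln (real n)"
proof -
  have "\<eta> * \<gamma> / c \<le> real n powr (3 / 2)"
    using c_pos \<eta>_pos \<gamma>_pos by (intro powr_3_2_ge n_ge) auto
  then have "\<eta> * \<gamma> / c * real n powr (3 / 2) \<le> real n powr (3 / 2) * real n powr (3 / 2)"
    by (intro mult_right_mono) auto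
  also have "\<dots> = real n powr 3" by (simp flip: powr_add)
  finally have *: "\<eta> * \<gamma> / c * real n powr (3 / 2) \<le> real n powr 3" .
  have "A = \<eta> * \<gamma> / c * real n powr (3 / 2) / sqrt 2" by (simp add: A_def)
  also have "\<dots> \<le> \<eta> * \<gamma> / c * real n powr (3 / 2) / 1"
    using c_pos \<eta>_pos \<gamma>_pos by (intro divide_left_mono) auto
  finally have "A \<le> real n powr 3" using * by simp
  then have "l \<le> ln (real n powr 3)"
    unfolding l_def using A_pos n_pos by (subst ln_le_cancel_iff) auto
  then show ?thesis using n_pos by (simp add: ln_realpow)
qed

lemma N_le: "real N * (2 * l) \<le> real n * \<gamma>"
proof -
  have "real N * (2 * (real k + 1)) \<le> real n - real k" using N_bounds(1) by (simp add: le_divide_eq)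
  then have "real N * (2 * (real k + 1)) * \<gamma> \<le> real n * \<gamma>" using \<gamma>_pos by (intro mult_right_mono) auto
  moreover have "real N * (2 * l) \<le> real N * (2 * ((real k + 1) * \<gamma>))"
    using k_gt by (intro mult_left_mono) auto
  moreover have "real N * (2 * ((real k + 1) * \<gamma>)) = real N * (2 * (real k + 1)) * \<gamma>"
    by (simp only: mult.assoc)
  ultimately show ?thesis by linarith
qed

lemma n_le: "real n \<le> 9 * real k * real N"
proof -
  \<comment> \<open>rounding down loses at most a factor 2, because \<open>N \<ge> 1\<close>\<close>
  have "(real n - real k) / (2 * (real k + 1)) \<le> 2 * real N" using N_bounds(2) N_ge_1 by linarith
  then have "real n - real k \<le> 2 * real N * (2 * (real k + 1))" by (simp add: divide_le_eq)
  also have "\<dots> \<le> 2 * real N * (3 * real k)" using k_ge_2 by (intro mult_left_mono) auto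
  finally have "real n - real k \<le> 6 * (real k * real N)" by (simp add: mult.commute)
  then show ?thesis using n_ge_3k by simp
qed

abbreviation r :: real where "r \<equiv> real n powr (- 1 / 2)"

lemma r_pos: "0 < r" using n_pos by simp

lemma \<eta>_eq: "\<eta> = A * (sqrt 2 * c * r / (real n * \<gamma>))"
proof -
  have "real n powr (3 / 2) * r = real n" using n_pos by (simp flip: powr_add)
  then have "A * (sqrt 2 * c * r / (real n * \<gamma>)) = \<eta> * (real n powr (3 / 2) * r) / real n"
    using c_pos \<gamma>_pos by (simp add: A_def)
  then show ?thesis using \<open>real n powr (3 / 2) * r = real n\<close> n_pos by simp
qed

lemma decay_at_lag: "\<eta> * exp (- \<gamma> * (real k + 1)) \<le> sqrt 2 * c * r / (real n * \<gamma>)"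
proof -
  have "exp (- \<gamma> * (real k + 1)) \<le> exp (- l)" using k_gt by (simp add: mult.commute)
  also have "\<dots> = 1 / A" using A_pos by (simp add: l_def exp_minus inverse_eq_divide)
  finally have "\<eta> * exp (- \<gamma> * (real k + 1)) \<le> \<eta> * (1 / A)" using \<eta>_pos by (intro mult_left_mono) auto
  also have "\<dots> = sqrt 2 * c * r / (real n * \<gamma>)" by (subst \<eta>_eq) (use A_pos in simp)
  finally show ?thesis .
qed

lemma N_decay_at_lag: "real N * (\<eta> * exp (- \<gamma> * (real k + 1))) \<le> sqrt 2 * c * r / (2 * l)"
proof -
  have "real N * (\<eta> * exp (- \<gamma> * (real k + 1))) \<le> real N * (sqrt 2 * c * r / (real n * \<gamma>))"
    by (intro mult_left_mono decay_at_lag) auto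
  also have "\<dots> \<le> real n * \<gamma> / (2 * l) * (sqrt 2 * c * r / (real n * \<gamma>))"
    using N_le l_pos c_pos n_pos \<gamma>_pos by (intro mult_right_mono) (auto simp: le_divide_eq)
  also have "\<dots> = sqrt 2 * c * r / (2 * l)" using n_pos \<gamma>_pos by simp
  finally show ?thesis .
qed

lemma inverse_sqrt_N_le: "1 / sqrt N \<le> 3 * sqrt k * r"
proof -
  have "r = 1 / sqrt n" using n_pos by (simp add: powr_minus powr_half_sqrt inverse_eq_divide)
  moreover have "1 / sqrt N \<le> 3 * sqrt k * (1 / sqrt n)"
  proof -
    have "sqrt n \<le> sqrt (9 * real k * real N)" using n_le by (rule real_sqrt_le_mono)
    then have "sqrt n \<le> 3 * sqrt k * sqrt N" by (simp add: real_sqrt_mult)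
    then show ?thesis using n_pos N_ge_1 by (simp add: field_simps)
  qed
  ultimately show ?thesis by (simp only:)
qed

lemma mean_bound:
  assumes c: "2 \<le> c" and b: "b1 \<le> \<eta> * exp (- \<gamma> * (real k + 1))" "b2 \<le> \<eta> * exp (- \<gamma> * (real k + 1))"
  shows "(c / 2 + sqrt c) / sqrt N + real N * (b1 + 2 * b2) \<le> sqrt 8 * c * r / \<gamma> * (exp 1 + l)"
proof -
  have s8: "sqrt 8 = 2 * sqrt 2" using real_sqrt_mult[of 4 2] by simp
  have sc: "sqrt c \<le> 3 / 4 * c"
  proof (rule real_le_lsqrt)
    have "c * (16 / 9) \<le> c * c" using c by (intro mult_left_mono) auto
    then show "c \<le> (3 / 4 * c)\<^sup>2" by (simp add: power2_eq_square)
  qed (use c in auto)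
  have sk: "15 / 4 * sqrt k \<le> sqrt 8 * (l / \<gamma>)"
  proof -
    have "sqrt 2 \<le> sqrt k" using k_ge_2 by simp
    then have "sqrt 2 * sqrt 2 * sqrt k \<le> sqrt 2 * sqrt k * sqrt k"
      by (intro mult_right_mono mult_left_mono) auto
    then have "2 * sqrt k \<le> sqrt 2 * sqrt k * sqrt k" by (simp only: real_sqrt_mult_self abs_numeral)
    then have "4 * sqrt k \<le> sqrt 8 * sqrt k * sqrt k" unfolding s8 by linarith
    also have "\<dots> = sqrt 8 * real k" by (simp add: mult.assoc)
    also have "\<dots> \<le> sqrt 8 * (l / \<gamma>)"
      using k_le \<gamma>_pos by (intro mult_left_mono) (auto simp: le_divide_eq)
    finally show ?thesis using real_sqrt_ge_zero[of "real k"] by linarith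
  qed
  have "(c / 2 + sqrt c) / sqrt N \<le> 5 / 4 * c * (1 / sqrt N)"
    using divide_right_mono[of "c / 2 + sqrt c" "5 / 4 * c" "sqrt N"] sc by simp
  also have "\<dots> \<le> 5 / 4 * c * (3 * sqrt k * r)"
    using c inverse_sqrt_N_le by (intro mult_left_mono) auto
  also have "\<dots> = c * r * (15 / 4 * sqrt k)" by simp
  also have "\<dots> \<le> c * r * (sqrt 8 * (l / \<gamma>))"
    using sk c r_pos by (intro mult_left_mono) auto
  finally have 1: "(c / 2 + sqrt c) / sqrt N \<le> sqrt 8 * c * r / \<gamma> * l" by (simp add: field_simps)
  have "real N * (b1 + 2 * b2) \<le> real N * (3 * (\<eta> * exp (- \<gamma> * (real k + 1))))"
    using b by (intro mult_left_mono) auto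
  also have "\<dots> \<le> 3 * (sqrt 2 * c * r / (2 * l))"
    using N_decay_at_lag by simp
  also have "\<dots> \<le> 3 * (sqrt 2 * c * r / (4 * \<gamma>))"
    using l_ge \<gamma>_pos l_pos c r_pos by (intro mult_left_mono divide_left_mono mult_pos_pos mult_nonneg_nonneg) auto
  also have "\<dots> = sqrt 8 * c * r / \<gamma> * (3 / 8)" using \<gamma>_pos by (simp add: s8)
  also have "\<dots> \<le> sqrt 8 * c * r / \<gamma> * exp 1"
  proof (rule mult_left_mono)
    show "3 / 8 \<le> exp (1 :: real)" using exp_ge_add_one_self[of 1] by linarith
  qed (use c r_pos \<gamma>_pos in auto)
  finally show ?thesis using 1 by (simp add: distrib_left)
qed

lemma exponent_bound: "\<gamma> * real n / (48 * ln (real n)) \<le> 2 * real N"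
proof -
  have ln: "0 < ln (real n)" using l_le l_pos by linarith
  have "\<gamma> * real n \<le> \<gamma> * (9 * real k * real N)" using n_le \<gamma>_pos by (intro mult_left_mono) auto
  also have "\<dots> = 9 * real N * (real k * \<gamma>)" by simp
  also have "\<dots> \<le> 9 * real N * (3 * ln (real n))" using k_le l_le by (intro mult_left_mono) auto
  also have "\<dots> \<le> 2 * real N * (48 * ln (real n))" using ln by simp
  finally show ?thesis using ln by (simp add: divide_le_eq)
qed

text \<open>
  From \<open>k \<ge> 2\<close> it follows that \<open>k - 1 \<ge> (k + 1) / 3\<close>, hence \<open>\<gamma> (k - 1) \<ge> l / 3 \<ge> 1 / 3\<close>: from lag \<open>k + 1\<close>
  to lag \<open>2 k\<close> the bound on \<open>\<beta>\<close> shrinks to at most \<open>3 / 4\<close> of its value, and \<open>1 + 2 \<cdot> 3 / 4 \<le> exp 1\<close>.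
\<close>

lemma dependence_error_bound:
  assumes l: "1 \<le> l" and b: "b1 \<le> \<eta> * exp (- \<gamma> * (real k + 1))" "b2 \<le> \<eta> * exp (- \<gamma> * (2 * real k))"
  shows "real N * (b1 + 2 * b2) \<le> exp 1 * sqrt 2 * c * r / (2 * l)"
proof -
  define B where "B = \<eta> * exp (- \<gamma> * (real k + 1))"
  have B: "0 \<le> B" using \<eta>_pos by (simp add: B_def)
  have "\<gamma> * (1 / 3 * (real k + 1)) \<le> \<gamma> * (real k - 1)" using k_ge_2 \<gamma>_pos by (intro mult_left_mono) auto
  then have "1 / 3 \<le> \<gamma> * (real k - 1)" using k_gt l by (simp add: mult.commute)
  then have "4 / 3 \<le> exp (\<gamma> * (real k - 1))"
    using exp_ge_add_one_self[of "\<gamma> * (real k - 1)"] by linarith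
  then have e34: "exp (- (\<gamma> * (real k - 1))) \<le> 3 / 4"
    unfolding exp_minus by (simp add: field_simps)
  have "- \<gamma> * (2 * real k) = - \<gamma> * (real k + 1) + - (\<gamma> * (real k - 1))" by (simp add: algebra_simps)
  then have "\<eta> * exp (- \<gamma> * (2 * real k)) = B * exp (- (\<gamma> * (real k - 1)))"
    unfolding B_def by (simp only: exp_add mult.assoc)
  also have "\<dots> \<le> B * (3 / 4)" using e34 B by (intro mult_left_mono) auto
  finally have "b1 + 2 * b2 \<le> 5 / 2 * B" using b unfolding B_def[symmetric] by linarith
  also have "\<dots> \<le> exp 1 * B"
    using exp_lower_Taylor_quadratic[of 1] B by (intro mult_right_mono) auto
  finally have "real N * (b1 + 2 * b2) \<le> real N * (exp 1 * B)" by (intro mult_left_mono) auto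
  also have "\<dots> = exp 1 * (real N * B)" by simp
  also have "\<dots> \<le> exp 1 * (sqrt 2 * c * r / (2 * l))"
    using N_decay_at_lag unfolding B_def[symmetric] by (rule mult_left_mono) simp
  finally show ?thesis by (simp add: mult.assoc)
qed

text \<open>
  If the exponential term is below \<open>1\<close>, then \<open>\<gamma> n \<epsilon>\<^sup>2 \<ge> 48\<close>; since \<open>\<eta>\<close> is \<open>A\<close> times
  \<open>\<surd>2 c r / (\<gamma> n)\<close>, this makes \<open>4 \<eta> / \<epsilon>\<close> a small multiple of \<open>c r\<close>.
\<close>

lemma Markov_error_bound:
  assumes l: "l \<le> 1" and c: "1 \<le> c" and \<epsilon>: "0 < \<epsilon>" "\<epsilon> \<le> 1"
    and W: "4 * c\<^sup>2 * exp (- (\<gamma> * real n * \<epsilon>\<^sup>2) / (48 * c ^ 4 * ln (real n))) < 1"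
  shows "4 * \<eta> / \<epsilon> \<le> exp 1 * sqrt 2 * c * r / (2 * l)"
proof -
  define w where "w = \<gamma> * real n * \<epsilon>\<^sup>2 / (48 * c ^ 4 * ln (real n))"
  have ln: "1 \<le> ln (real n)"
  proof -
    have "exp (1 :: real) \<le> 3" by (rule exp_le)
    then have "exp 1 \<le> real n" using n_ge_3k k_ge_2 by linarith
    then show ?thesis using n_pos by (simp add: ln_ge_iff)
  qed
  have "1 \<le> w"
  proof (rule ccontr)
    assume "\<not> 1 \<le> w"
    then have "exp (- 1) \<le> exp (- w)" by simp
    moreover have "1 / 3 \<le> exp (- 1 :: real)"
      using exp_le by (simp add: exp_minus field_simps)
    ultimately have "1 / 3 \<le> exp (- w)" by linarith
    moreover have "1 \<le> c\<^sup>2" using c by (simp add: one_le_power)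
    ultimately have "4 * 1 * (1 / 3) \<le> 4 * c\<^sup>2 * exp (- w)" by (intro mult_mono) auto
    then show False using W unfolding w_def by simp
  qed
  moreover have c4: "1 \<le> c ^ 4" using c by (simp add: one_le_power)
  moreover have "48 * 1 * 1 \<le> 48 * c ^ 4 * ln (real n)" using c4 ln by (intro mult_mono) auto
  ultimately have "48 \<le> \<gamma> * real n * \<epsilon>\<^sup>2"
    using pos_le_divide_eq[of "48 * c ^ 4 * ln (real n)" 1 "\<gamma> * real n * \<epsilon>\<^sup>2"]
    unfolding w_def[symmetric] by linarith
  also have "\<dots> \<le> \<gamma> * real n * \<epsilon>"
    using \<epsilon> \<gamma>_pos by (intro mult_left_mono) (auto simp: power2_eq_square mult_left_le)
  finally have gn: "48 \<le> \<gamma> * real n * \<epsilon>" .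
  have "A = exp l" using A_pos by (simp add: l_def)
  then have "A \<le> exp 1" using l by simp
  have "4 * \<eta> / \<epsilon> = 4 * A * (sqrt 2 * c * r) / (\<gamma> * real n * \<epsilon>)"
    by (subst \<eta>_eq) (simp add: mult_ac)
  also have "\<dots> \<le> 4 * exp 1 * (sqrt 2 * c * r) / (\<gamma> * real n * \<epsilon>)"
    using \<open>A \<le> exp 1\<close> gn c r_pos by (intro divide_right_mono mult_right_mono) auto
  also have "\<dots> \<le> 4 * exp 1 * (sqrt 2 * c * r) / 48"
    using gn c r_pos by (intro divide_left_mono) auto
  also have "\<dots> \<le> 4 * exp 1 * (sqrt 2 * c * r) / (8 * l)"
    using l l_pos c r_pos by (intro divide_left_mono) auto
  also have "\<dots> = exp 1 * sqrt 2 * c * r / (2 * l)" using l_pos by simp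
  finally show ?thesis .
qed

end

theorem theorem5:
  fixes M :: "'a measure" and X :: "nat \<Rightarrow> 'a \<Rightarrow> real" and S :: "real set"
    and \<eta> \<gamma> :: real and n k N :: nat
  assumes "prob_space M"
    and "\<And>t. X t \<in> borel_measurable M"
    and "finite S"
    and "\<And>t \<omega>. \<omega> \<in> space M \<Longrightarrow> X t \<omega> \<in> S"
    and "stationary_process M X"
    and "markov_process M X"
    and "geometrically_ergodic M X"
    and "\<eta> > 0" and "\<gamma> > 0"
    and "\<And>j. beta_coeff M X S j \<le> \<eta> * exp (- \<gamma> * real j)"
    and "k = nat \<lfloor>1 / \<gamma> * ln (\<eta> * \<gamma> * real n powr (3 / 2) / (sqrt 2 * real (card S)))\<rfloor>"
    and "N = nat \<lfloor>(real n - real k) / (2 * (real k + 1))\<rfloor>"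
    and "N \<ge> 1"
    and "real n \<ge> max ((sqrt 2 * real (card S) * exp (2 * \<gamma>) / (\<eta> * \<gamma>)) powr (2 / 3))
                       ((\<eta> * \<gamma> / real (card S)) powr (2 / 3))"
  shows "\<forall>m\<in>{1..k}.
    prob_space.expectation M (\<lambda>\<omega>. \<bar>beta_hat X S k N m \<omega> - beta_coeff M X S m\<bar>)
      \<le> sqrt 8 * real (card S) * real n powr (- 1 / 2) / \<gamma>
          * (exp 1 + ln (\<eta> * \<gamma> / (sqrt 2 * real (card S))) + 3 / 2 * ln (real n))
    \<and> (\<forall>\<epsilon>>0. \<P>(\<omega> in M. \<bar>beta_hat X S k N m \<omega> - beta_coeff M X S m\<bar> \<ge> \<epsilon>)
        \<le> exp 1 * sqrt 2 * real (card S) * real n powr (- 1 / 2)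
            / (2 * ln (\<eta> * \<gamma> * real n powr (3 / 2) / (sqrt 2 * real (card S))))
          + 4 * real (card S) ^ 2
            * exp (- (\<gamma> * real n * \<epsilon>\<^sup>2) / (48 * real (card S) ^ 4 * ln (real n))))"
proof
  fix m assume m: "m \<in> {1..k}"
  interpret stationary_markov_chain M X S
    using assms(1-6) by (intro stationary_markov_chain.intro stationary_markov_chain_axioms.intro)
  obtain \<omega>0 where "\<omega>0 \<in> space M" using not_empty by blast
  then have "S \<noteq> {}" using X_in by blast
  then have card_pos: "0 < card S" using finite_S by (simp add: card_gt_0_iff)
  define c where "c = real (card S)"
  have c1: "1 \<le> c" using card_pos by (simp add: c_def)
  interpret lag_choice c \<eta> \<gamma> n k N
    using assms(8-14) c1 unfolding c_def by unfold_locales auto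
  define D where "D = (\<lambda>\<omega>. \<bar>beta_hat X S k N m \<omega> - beta_coeff M X S m\<bar>)"
  have N: "0 < N" using N_ge_1 by simp
  have mk: "m \<le> 2 * (k + 1)" using m by simp
  have decay: "\<beta> j \<le> \<eta> * exp (- \<gamma> * (real k + 1))" if "k + 1 \<le> j" for j
  proof -
    have "real k + 1 \<le> real j" using that by linarith
    then have "\<gamma> * (real k + 1) \<le> \<gamma> * real j" using \<gamma>_pos by (intro mult_left_mono) auto
    then have "\<eta> * exp (- \<gamma> * real j) \<le> \<eta> * exp (- \<gamma> * (real k + 1))" using \<eta>_pos by simp
    then show ?thesis using assms(10)[of j] by linarith
  qed
  have k2: "2 \<le> k" using k_ge_2 by linarith
  have b1: "\<beta> (2 * (k + 1) - m) \<le> \<eta> * exp (- \<gamma> * (real k + 1))" using m by (intro decay) auto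
  have b2: "\<beta> (2 * k) \<le> \<eta> * exp (- \<gamma> * (real k + 1))" using k2 by (intro decay) auto
  have b2': "\<beta> (2 * k) \<le> \<eta> * exp (- \<gamma> * (2 * real k))" using assms(10)[of "2 * k"] by simp
  have \<eta>: "\<beta> 0 \<le> \<eta>" using assms(10)[of 0] by simp
  have beta_0_singleton: "\<beta> 0 = 0" if one: "card S = 1"
  proof -
    obtain x where "S = {x}" using one by (rule card_1_singletonE)
    then have "(\<Sum>u\<in>S. \<pi> u * (1 - \<pi> u)) = 0" using sum_\<pi> by simp
    then show ?thesis by (simp only: beta_0)
  qed
  have l_eq: "ln (\<eta> * \<gamma> / (sqrt 2 * c)) + 3 / 2 * ln (real n) = l"
  proof -
    define a where "a = \<eta> * \<gamma> / (sqrt 2 * c)"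
    have "0 < a" using c_pos \<eta>_pos \<gamma>_pos by (simp add: a_def)
    moreover have "A = a * real n powr (3 / 2)" by (simp add: A_def a_def)
    ultimately show ?thesis
      unfolding l_def a_def[symmetric] using n_pos by (simp add: ln_mult ln_powr)
  qed
  have "expectation D \<le> sqrt 8 * c * r / \<gamma> * (exp 1 + l)"
  proof (cases "card S = 1")
    case True
    have "expectation D \<le> 0"
      using expectation_deviation_le_beta_0[OF N, of k m] beta_0_singleton[OF True] by (simp add: D_def)
    also have "0 \<le> sqrt 8 * c * r / \<gamma> * (exp 1 + l)"
      using c_pos \<gamma>_pos l_pos by (intro mult_nonneg_nonneg divide_nonneg_nonneg add_nonneg_nonneg) auto
    finally show ?thesis .
  next
    case False
    then have "2 \<le> c" using card_pos by (simp add: c_def)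
    then show ?thesis
      unfolding D_def
      by (rule order_trans[OF mean_deviation[OF N mk, folded c_def] mean_bound[OF _ b1 b2]])
  qed
  then have mean: "expectation D \<le> sqrt 8 * c * r / \<gamma> * (exp 1 + ln (\<eta> * \<gamma> / (sqrt 2 * c)) + 3 / 2 * ln (real n))"
    using l_eq by (simp add: add.assoc)
  have tail: "prob {\<omega> \<in> space M. \<epsilon> \<le> D \<omega>} \<le> exp 1 * sqrt 2 * c * r / (2 * l)
      + 4 * c\<^sup>2 * exp (- (\<gamma> * real n * \<epsilon>\<^sup>2) / (48 * c ^ 4 * ln (real n)))" (is "?p \<le> ?T1 + ?T2")
    if \<epsilon>: "0 < \<epsilon>" for \<epsilon>
  proof -
    have T1: "0 \<le> ?T1" using c_pos l_pos by simp
    have T2: "0 \<le> ?T2" by simp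
    have Markov: "?p \<le> 4 * \<beta> 0 / \<epsilon>" unfolding D_def by (rule tail_le_beta_0[OF N \<epsilon>])
    \<comment> \<open>the first three cases are degenerate; the last two are separated by the size of \<open>l\<close>\<close>
    consider "card S = 1" | "1 < \<epsilon>" | "1 \<le> ?T2" | "2 \<le> card S" "1 \<le> l" | "\<epsilon> \<le> 1" "?T2 < 1" "l \<le> 1"
      using card_pos by linarith
    then show ?thesis
    proof cases
      case 1
      then have "?p \<le> 0" using Markov beta_0_singleton by simp
      then show ?thesis using T1 T2 by linarith
    next
      case 2
      have "D \<omega> < \<epsilon>" if "\<omega> \<in> space M" for \<omega>
        using deviation_le_1[OF that N, of k m] 2 unfolding D_def by linarith
      then have "{\<omega> \<in> space M. \<epsilon> \<le> D \<omega>} = {}" by (auto simp: not_le)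
      then have "?p = 0" by (simp only: measure_empty)
      then show ?thesis using T1 T2 by linarith
    next
      case 3
      then show ?thesis using T1 prob_le_1[of "{\<omega> \<in> space M. \<epsilon> \<le> D \<omega>}"] by linarith
    next
      case 4
      have "?p \<le> real N * (\<beta> (2 * (k + 1) - m) + 2 * \<beta> (2 * k)) + 4 * c\<^sup>2 * exp (- (2 * real N * \<epsilon>\<^sup>2 / c ^ 4))"
        unfolding D_def c_def by (rule tail_deviation[OF N mk 4(1) \<epsilon>])
      moreover have "real N * (\<beta> (2 * (k + 1) - m) + 2 * \<beta> (2 * k)) \<le> ?T1"
        by (rule dependence_error_bound[OF 4(2) b1 b2'])
      moreover have "4 * c\<^sup>2 * exp (- (2 * real N * \<epsilon>\<^sup>2 / c ^ 4)) \<le> ?T2"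
      proof -
        have "\<gamma> * real n / (48 * ln (real n)) * (\<epsilon>\<^sup>2 / c ^ 4) \<le> 2 * real N * (\<epsilon>\<^sup>2 / c ^ 4)"
          by (intro mult_right_mono exponent_bound) auto
        then have "- (2 * real N * \<epsilon>\<^sup>2 / c ^ 4) \<le> - (\<gamma> * real n * \<epsilon>\<^sup>2) / (48 * c ^ 4 * ln (real n))"
          by (simp add: mult_ac)
        then show ?thesis by (intro mult_left_mono) auto
      qed
      ultimately show ?thesis by linarith
    next
      case 5
      have "4 * \<beta> 0 / \<epsilon> \<le> 4 * \<eta> / \<epsilon>" using \<eta> \<epsilon> by (intro divide_right_mono) auto
      also have "\<dots> \<le> ?T1" by (rule Markov_error_bound[OF 5(3) c1 \<epsilon> 5(1,2)])
      finally show ?thesis using Markov T2 by linarith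
    qed
  qed
  show "expectation (\<lambda>\<omega>. \<bar>beta_hat X S k N m \<omega> - beta_coeff M X S m\<bar>)
      \<le> sqrt 8 * real (card S) * real n powr (- 1 / 2) / \<gamma>
          * (exp 1 + ln (\<eta> * \<gamma> / (sqrt 2 * real (card S))) + 3 / 2 * ln (real n))
    \<and> (\<forall>\<epsilon>>0. \<P>(\<omega> in M. \<bar>beta_hat X S k N m \<omega> - beta_coeff M X S m\<bar> \<ge> \<epsilon>)
        \<le> exp 1 * sqrt 2 * real (card S) * real n powr (- 1 / 2)
            / (2 * ln (\<eta> * \<gamma> * real n powr (3 / 2) / (sqrt 2 * real (card S))))
          + 4 * real (card S) ^ 2
            * exp (- (\<gamma> * real n * \<epsilon>\<^sup>2) / (48 * real (card S) ^ 4 * ln (real n))))"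
    by (intro conjI allI impI mean[unfolded D_def c_def] tail[unfolded D_def l_def A_def, unfolded c_def])
qed

end
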